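(* Let $(Q,\le_Q)$ be a better-quasi-ordering. Then $(\mathcal{C}',\preceq)$ is a better-quasi-ordering, where $\mathcal{C}'$ is the family of $Q$-labeled countable closed linear orderings generated from the empty and singleton ones by iterating unbounded sums (see context) and $\preceq$ is $Q$-smc-embeddability.
   Context: **Better-quasi-orderings.** A quasi-ordering is a reflexive transitive relation. For a finite $c\subseteq\mathbb{N}$ and any $d\subseteq\mathbb{N}$, $d$ extends $c$ if $c=\{i\in d: i\le\max c\}$, i.e. $c$ is a (not necessarily proper) initial segment of $d$. An infinite set $B$ of finite subsets of $\mathbb{N}$ is a block if every infinite $X\subseteq\bigcup B$ has an initial segment in $B$; a block is a barrier if no two distinct elements of $B$ are comparable with respect to inclusion. For $b_1,b_2\in B$ write $b_1\vartriangleleft b_2$ if there are $i_1<i_2<\dots<i_m$ and $k$ with $1\le k<m$ such that $b_1=\{i_1,\dots,i_k\}$ and $b_2=\{i_2,\dots,i_m\}$. A function $f:B\to Q$ from a barrier to a quasi-ordering is bad if $f(b_1)\not\le f(b_2)$ whenever $b_1\vartriangleleft b_2$; otherwise it is good. $Q$ is a better-quasi-ordering (bqo) if every $f:B\to Q$ is good, for every barrier $B$. **$Q$-cclo's.** A countable closed linear ordering (cclo) is a countable closed subset of $\mathbb{R}$. A smc embedding (strictly monotone continuous embedding) between cclo's $V_1,V_2$ is a map $h:V_1\to V_2$ that is strictly increasing and such that whenever $p_n\in V_1$ converges in $\mathbb{R}$ to $p\in V_1$, then $h(p_n)$ converges to $h(p)$. A $Q$-cclo is a function $A$ whose domain $\operatorname{dom}A$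 is a cclo and whose range is contained in $Q$. For $Q$-cclo's, $A\preceq B$ means that there is a smc embedding $h:\operatorname{dom}A\to\operatorname{dom}B$ with $A(a)\le_Q B(h(a))$ for all $a\in\operatorname{dom}A$. **Sums.** For sets of reals, $A<B$ means $A=\emptyset$ or $B=\emptyset$ or $\sup A<\inf B$. The expression $$L_0+L_1+L_2+\dots+p+\dots+{}_2L+{}_1L+{}_0L$$ is allowed only if: $p\in Q$; all $L_i$ and ${}_iL$ ($i\in\mathbb{N}$) are $Q$-cclo's; either all $L_i$ are empty or none is; either all ${}_iL$ are empty or none is; not all of the $L_i$ and ${}_iL$ are empty; $\operatorname{dom}L_i<\operatorname{dom}L_{i+1}<\operatorname{dom}{}_{i+1}L<\operatorname{dom}{}_iL$ for all $i$; and there is a real $x$ such that $x=\lim a_n$ for all choices $a_n\in\operatorname{dom}L_n$ (if the $L_n$ are nonempty) and $x=\lim {}_na$ for all choices ${}_na\in\operatorname{dom}{}_nL$ (if the ${}_nL$ are nonempty). It denotes the $Q$-cclo $L$ with domain $\bigcup_i\operatorname{dom}L_i\cup\{x\}\cup\bigcup_i\operatorname{dom}{}_iL$ which extends all $L_i$ and ${}_iL$ and has $L(x)=p$. **Unbounded sums and $\mathcal{C}'$.** For a class $\mathcal{O}$ of $Q$-cclo's, $S'(\mathcal{O})$ is the set of all $Q$-cclo's of the form $L_0+L_1+\dots+p+\dots+{}_1L+{}_0L$ with $p\in Q$, all $L_n,{}_nL\in\mathcal{O}$, and such that for all $n$ there is $k>n$ with $L_n\preceq L_k$, and for all $n$ there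 is $k>n$ with ${}_nL\preceq{}_kL$. Let $\mathcal{C}'_0$ be the set of all $Q$-cclo's with singleton or empty domain, $\mathcal{C}'_{\alpha+1}=S'(\mathcal{C}'_\alpha)\cup\mathcal{C}'_\alpha$, $\mathcal{C}'_\delta=\bigcup_{\alpha<\delta}\mathcal{C}'_\alpha$ for limit $\delta>0$, and $\mathcal{C}'=\mathcal{C}'_{\omega_1}$. *)

theory Defs
  imports Complex_Main "HOL-Library.Extended_Real"
begin

section \<open>Better-quasi-orderings\<close>

definition quasi_order_on :: "'a set \<Rightarrow> ('a \<Rightarrow> 'a \<Rightarrow> bool) \<Rightarrow> bool" where
  "quasi_order_on Q le \<longleftrightarrow> reflp_on Q le \<and> transp_on Q le"

text \<open>The empty set is an initial segment of every set; it is treated separately because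
  \<^term>\<open>Max {}\<close> is unspecified.\<close>

definition initial_segment :: "nat set \<Rightarrow> nat set \<Rightarrow> bool" where
  "initial_segment c d \<longleftrightarrow> finite c \<and> (c = {} \<or> c = {i \<in> d. i \<le> Max c})"

definition block :: "nat set set \<Rightarrow> bool" where
  "block B \<longleftrightarrow> infinite B \<and> (\<forall>b\<in>B. finite b) \<and>
     (\<forall>X. infinite X \<and> X \<subseteq> \<Union>B \<longrightarrow> (\<exists>b\<in>B. initial_segment b X))"

definition barrier :: "nat set set \<Rightarrow> bool" where
  "barrier B \<longleftrightarrow> block B \<and> (\<forall>b\<in>B. \<forall>c\<in>B. b \<noteq> c \<longrightarrow> \<not> b \<subseteq> c \<and> \<not> c \<subseteq> b)"

definition shift_rel :: "nat set \<Rightarrow> nat set \<Rightarrow> bool" (infix "\<lhd>" 50) where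
  "b \<lhd> c \<longleftrightarrow> (\<exists>(i :: nat \<Rightarrow> nat) m k. strict_mono_on {1..m} i \<and> 1 \<le> k \<and> k < m \<and>
     b = i ` {1..k} \<and> c = i ` {2..m})"

definition bad_on :: "nat set set \<Rightarrow> ('a \<Rightarrow> 'a \<Rightarrow> bool) \<Rightarrow> (nat set \<Rightarrow> 'a) \<Rightarrow> bool" where
  "bad_on B le f \<longleftrightarrow> (\<forall>b\<in>B. \<forall>c\<in>B. b \<lhd> c \<longrightarrow> \<not> le (f b) (f c))"

definition bqo_on :: "'a set \<Rightarrow> ('a \<Rightarrow> 'a \<Rightarrow> bool) \<Rightarrow> bool" where
  "bqo_on Q le \<longleftrightarrow> quasi_order_on Q le \<and>
     (\<forall>B f. barrier B \<and> f ` B \<subseteq> Q \<longrightarrow> \<not> bad_on B le f)"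

section \<open>Labelled countable closed linear orderings\<close>

definition cclo :: "real set \<Rightarrow> bool" where
  "cclo V \<longleftrightarrow> countable V \<and> closed V"

text \<open>Only the values of \<^term>\<open>h\<close> on \<^term>\<open>V\<close> matter.\<close>

definition smc_embedding :: "real set \<Rightarrow> real set \<Rightarrow> (real \<Rightarrow> real) \<Rightarrow> bool" where
  "smc_embedding V W h \<longleftrightarrow> h ` V \<subseteq> W \<and> strict_mono_on V h \<and>
     (\<forall>p x. (\<forall>n :: nat. p n \<in> V) \<and> x \<in> V \<and> p \<longlonglongrightarrow> x \<longrightarrow> (\<lambda>n. h (p n)) \<longlonglongrightarrow> h x)"

definition qcclos :: "'q set \<Rightarrow> (real \<rightharpoonup> 'q) set" where
  "qcclos Q = {A. cclo (dom A) \<and> ran A \<subseteq> Q}"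

definition qcclo_le :: "('q \<Rightarrow> 'q \<Rightarrow> bool) \<Rightarrow> (real \<rightharpoonup> 'q) \<Rightarrow> (real \<rightharpoonup> 'q) \<Rightarrow> bool" where
  "qcclo_le le A B \<longleftrightarrow> (\<exists>h. smc_embedding (dom A) (dom B) h \<and>
     (\<forall>a\<in>dom A. le (the (A a)) (the (B (h a)))))"

section \<open>Sums\<close>

text \<open>Suprema and infima are taken in the extended reals, as the sets may be unbounded.\<close>

definition set_less :: "real set \<Rightarrow> real set \<Rightarrow> bool" where
  "set_less A B \<longleftrightarrow> A = {} \<or> B = {} \<or> Sup (ereal ` A) < Inf (ereal ` B)"

text \<open>\<^term>\<open>L i\<close> and \<^term>\<open>R i\<close> are the left summand with index \<^term>\<open>i\<close> and
  the right summand with index \<^term>\<open>i\<close>; the right summands descend towards \<^term>\<open>x\<close>.\<close>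

definition sum_allowed ::
    "'q set \<Rightarrow> (nat \<Rightarrow> real \<rightharpoonup> 'q) \<Rightarrow> 'q \<Rightarrow> (nat \<Rightarrow> real \<rightharpoonup> 'q) \<Rightarrow> real \<Rightarrow> bool" where
  "sum_allowed Q L p R x \<longleftrightarrow>
     p \<in> Q \<and> (\<forall>i. L i \<in> qcclos Q) \<and> (\<forall>i. R i \<in> qcclos Q) \<and>
     ((\<forall>i. dom (L i) = {}) \<or> (\<forall>i. dom (L i) \<noteq> {})) \<and>
     ((\<forall>i. dom (R i) = {}) \<or> (\<forall>i. dom (R i) \<noteq> {})) \<and>
     \<not> ((\<forall>i. dom (L i) = {}) \<and> (\<forall>i. dom (R i) = {})) \<and>
     (\<forall>i. set_less (dom (L i)) (dom (L (Suc i))) \<and>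
          set_less (dom (L (Suc i))) (dom (R (Suc i))) \<and>
          set_less (dom (R (Suc i))) (dom (R i))) \<and>
     (\<forall>a. (\<forall>n. a n \<in> dom (L n)) \<longrightarrow> a \<longlonglongrightarrow> x) \<and>
     (\<forall>a. (\<forall>n. a n \<in> dom (R n)) \<longrightarrow> a \<longlonglongrightarrow> x)"

definition is_sum ::
    "'q set \<Rightarrow> (nat \<Rightarrow> real \<rightharpoonup> 'q) \<Rightarrow> 'q \<Rightarrow> (nat \<Rightarrow> real \<rightharpoonup> 'q) \<Rightarrow> (real \<rightharpoonup> 'q) \<Rightarrow> bool" where
  "is_sum Q L p R A \<longleftrightarrow> (\<exists>x. sum_allowed Q L p R x \<and>
     dom A = (\<Union>i. dom (L i)) \<union> {x} \<union> (\<Union>i. dom (R i)) \<and>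
     (\<forall>i. L i \<subseteq>\<^sub>m A) \<and> (\<forall>i. R i \<subseteq>\<^sub>m A) \<and> A x = Some p)"

definition unbounded_sums ::
    "'q set \<Rightarrow> ('q \<Rightarrow> 'q \<Rightarrow> bool) \<Rightarrow> (real \<rightharpoonup> 'q) set \<Rightarrow> (real \<rightharpoonup> 'q) set" where
  "unbounded_sums Q le \<O> = {A \<in> qcclos Q. \<exists>L p R. is_sum Q L p R A \<and>
     (\<forall>n. L n \<in> \<O>) \<and> (\<forall>n. R n \<in> \<O>) \<and>
     (\<forall>n. \<exists>k>n. qcclo_le le (L n) (L k)) \<and>
     (\<forall>n. \<exists>k>n. qcclo_le le (R n) (R k))}"

section \<open>The transfinite hierarchy\<close>

text \<open>The countable ordinals are represented by the field of the well-order
  \<^term>\<open>cardSuc natLeq\<close>, which is the least uncountable cardinal.\<close>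

abbreviation omega1 :: "nat set rel" where
  "omega1 \<equiv> cardSuc natLeq"

lemma Card_order_omega1: "Card_order omega1"
  by (simp add: cardSuc_Card_order natLeq_Card_order)

lemma Well_order_omega1: "Well_order omega1"
  using Card_order_omega1 by (simp add: card_order_on_def)

lemma wo_rel_omega1: "wo_rel omega1"
  by (simp add: wo_rel_def Well_order_omega1)

lemma infinite_Field_omega1: "infinite (Field omega1)"
  using cardSuc_finite[OF natLeq_Card_order] by (simp add: Field_natLeq)

lemma AboveS_omega1:
  assumes "\<beta> \<in> Field omega1"
  shows "AboveS omega1 {\<beta>} \<noteq> {}"
  using infinite_Card_order_limit[OF Card_order_omega1 infinite_Field_omega1 assms]
  by (auto simp: AboveS_def)

definition succ1 :: "nat set \<Rightarrow> nat set" where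
  "succ1 \<beta> = wo_rel.suc omega1 {\<beta>}"

lemma underS_succ1:
  assumes "\<beta> \<in> Field omega1"
  shows "\<beta> \<in> underS omega1 (succ1 \<beta>)"
  using wo_rel.suc_greater[OF wo_rel_omega1, of "{\<beta>}" \<beta>] AboveS_omega1[OF assms] assms
  by (auto simp: underS_def succ1_def)

function C'_stage ::
    "'q set \<Rightarrow> ('q \<Rightarrow> 'q \<Rightarrow> bool) \<Rightarrow> nat set \<Rightarrow> (real \<rightharpoonup> 'q) set" where
  "C'_stage Q le \<alpha> =
    (if underS omega1 \<alpha> = {} then {A \<in> qcclos Q. dom A = {} \<or> is_singleton (dom A)}
     else if \<exists>\<beta>\<in>Field omega1. \<alpha> = succ1 \<beta>
     then (\<Union>\<beta>\<in>{\<beta> \<in> Field omega1. \<alpha> = succ1 \<beta>}.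
             unbounded_sums Q le (C'_stage Q le \<beta>) \<union> C'_stage Q le \<beta>)
     else (\<Union>\<beta>\<in>underS omega1 \<alpha>. C'_stage Q le \<beta>))"
  by auto

termination
proof (relation "inv_image (omega1 - Id) (\<lambda>(_, _, \<alpha>). \<alpha>)", goal_cases)
  case 1
  show ?case
    using Well_order_omega1 by (simp add: well_order_on_def)
qed (use underS_succ1 in \<open>auto simp: underS_def\<close>)

declare C'_stage.simps [simp del]

lemma C'_stage_zero:
  "underS omega1 \<alpha> = {} \<Longrightarrow>
    C'_stage Q le \<alpha> = {A \<in> qcclos Q. dom A = {} \<or> is_singleton (dom A)}"
  by (simp add: C'_stage.simps)

lemma succ1_inject:
  assumes "\<beta> \<in> Field omega1" "\<gamma> \<in> Field omega1" "succ1 \<beta> = succ1 \<gamma>"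
  shows "\<beta> = \<gamma>"
proof (rule ccontr)
  have no: False
    if a: "\<beta> \<in> Field omega1" and g: "\<gamma> \<in> Field omega1"
      and e: "succ1 \<beta> = succ1 \<gamma>" and lt: "(\<beta>, \<gamma>) \<in> omega1" "\<beta> \<noteq> \<gamma>" for \<beta> \<gamma>
  proof -
    have "\<gamma> \<in> AboveS omega1 {\<beta>}"
      using lt g by (auto simp: AboveS_def)
    hence "(succ1 \<beta>, \<gamma>) \<in> omega1"
      unfolding succ1_def by (rule wo_rel.suc_least_AboveS[OF wo_rel_omega1])
    moreover have "(\<gamma>, succ1 \<gamma>) \<in> omega1" "\<gamma> \<noteq> succ1 \<gamma>"
      using underS_succ1[OF g] by (auto simp: underS_def)
    ultimately show False
      using e wo_rel.ANTISYM[OF wo_rel_omega1] by (auto simp: antisym_def)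
  qed
  assume "\<beta> \<noteq> \<gamma>"
  moreover from this have "(\<beta>, \<gamma>) \<in> omega1 \<or> (\<gamma>, \<beta>) \<in> omega1"
    using wo_rel.TOTALS[OF wo_rel_omega1] assms by blast
  ultimately show False
    using no[of \<beta> \<gamma>] no[of \<gamma> \<beta>] assms by auto
qed

lemma C'_stage_succ:
  assumes "\<beta> \<in> Field omega1"
  shows "C'_stage Q le (succ1 \<beta>) =
    unbounded_sums Q le (C'_stage Q le \<beta>) \<union> C'_stage Q le \<beta>"
proof -
  have "{\<gamma> \<in> Field omega1. succ1 \<beta> = succ1 \<gamma>} = {\<beta>}"
    using succ1_inject assms by blast
  thus ?thesis
    using underS_succ1[OF assms] assms by (subst C'_stage.simps) auto
qed

lemma C'_stage_limit:
  assumes "underS omega1 \<alpha> \<noteq> {}" "\<And>\<beta>. \<beta> \<in> Field omega1 \<Longrightarrow> \<alpha> \<noteq> succ1 \<beta>"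
  shows "C'_stage Q le \<alpha> = (\<Union>\<beta>\<in>underS omega1 \<alpha>. C'_stage Q le \<beta>)"
  using assms by (subst C'_stage.simps) auto

text \<open>The stage of the limit ordinal \<open>\<omega>\<^sub>1\<close> itself.\<close>

definition C' :: "'q set \<Rightarrow> ('q \<Rightarrow> 'q \<Rightarrow> bool) \<Rightarrow> (real \<rightharpoonup> 'q) set" where
  "C' Q le = (\<Union>\<alpha>\<in>Field omega1. C'_stage Q le \<alpha>)"

end

theory Submission
  imports Defs "HOL-Library.Nat_Bijection" "HOL-Library.Infinite_Set"
begin

text \<open>
  Why the theorem holds.  A barrier is a set of finite sets, but a bad function on it is best seen as
  a function \<open>f\<close> on the infinite subsets \<open>X\<close> of an infinite \<open>M \<subseteq> \<nat>\<close>, where \<open>f X\<close> depends only on a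
  finite initial segment of \<open>X\<close>: the relation \<open>b \<lhd> c\<close> becomes the passage from \<open>X\<close> to \<open>tail X\<close>, that
  is, \<open>X\<close> without its least element.  In these terms \<open>Q\<close> is a better-quasi-ordering iff there is no
  bad array, i.e. no continuous \<open>f\<close> with \<open>f X \<in> Q\<close> and \<open>\<not> f X \<le> f (tail X)\<close> for all \<open>X\<close>
  (\<open>bqo_on_iff_arrays\<close>).

  Two combinatorial facts carry the proof.  The first is the Ramsey theorem of Nash-Williams for open
  sets of infinite sets (\<open>open_ramsey\<close>), which makes any continuous alternative uniform after passing
  to a smaller \<open>M\<close>.  The second is the minimal bad array lemma (\<open>minimal_bad_array\<close>): if \<open><\<close> is a
  well-founded transitive relation contained in \<open>\<le>\<close> and there is a bad array, then there is one below
  which no bad array is everywhere strictly smaller.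

  A nonempty member \<open>A\<close> of \<open>C'\<close> has a decomposition into a central label \<open>p\<close>, left summands \<open>L i\<close> and
  right summands \<open>R i\<close> of smaller rank in the hierarchy, where a singleton counts as a sum without
  summands.  If \<open>A\<close> and \<open>B\<close> are decomposed in this way, the label of \<open>A\<close> is below that of \<open>B\<close>, and
  each left (right) summand of \<open>A\<close> embeds into some left (right) summand of \<open>B\<close>, then \<open>A\<close> embeds into
  \<open>B\<close> (\<open>qcclo_le_decomposed\<close>): as the sums are unbounded, the summands of \<open>A\<close> can be sent, in their
  order, into distinct and ever later summands of \<open>B\<close>.

  Now take a bad array \<open>f\<close> into \<open>C'\<close> that is minimal with respect to smaller rank together with
  embeddability.  Badness at \<open>X\<close> has one of three reasons: the labels of \<open>f X\<close> and \<open>f (tail X)\<close> are not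
  related, or some left summand of \<open>f X\<close> embeds into no left summand of \<open>f (tail X)\<close>, or likewise on
  the right.  By the Ramsey theorem one reason may be assumed for all \<open>X\<close>.  The first makes the
  labels a bad array into \<open>Q\<close>.  In the other cases the offending summands form a bad array that is
  strictly below \<open>f\<close>, as summands embed into the sum.  Both are impossible.
\<close>

section \<open>Infinite sets of natural numbers and continuity\<close>

text \<open>The infinite subsets of \<open>M\<close>.\<close>

definition subs :: "nat set \<Rightarrow> nat set set" where
  "subs M = {X. infinite X \<and> X \<subseteq> M}"

text \<open>\<open>X\<close> without its least element; the intended arguments are infinite sets.\<close>

definition tail :: "nat set \<Rightarrow> nat set" where
  "tail X = X - {LEAST n. n \<in> X}"

lemma subs_mono: "N \<subseteq> M \<Longrightarrow> X \<in> subs N \<Longrightarrow> X \<in> subs M"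
  by (auto simp: subs_def)

lemma tail_subs: "X \<in> subs M \<Longrightarrow> tail X \<in> subs M"
  by (auto simp: subs_def tail_def)

lemma infinite_Int_greaterThan:
  assumes "infinite (X :: nat set)"
  shows "infinite (X \<inter> {m<..})"
proof
  assume "finite (X \<inter> {m<..})"
  hence "finite (X \<inter> {m<..} \<union> {..m})" by simp
  moreover have "X \<subseteq> X \<inter> {m<..} \<union> {..m}" by auto
  ultimately show False using assms finite_subset by blast
qed

lemma infinite_Int_atLeast:
  assumes "infinite (X :: nat set)"
  shows "infinite (X \<inter> {m..})"
  using infinite_Int_greaterThan[OF assms, of m] by (rule contrapos_nn) (rule finite_subset[rotated], auto)

lemma agree_le:
  assumes "j \<le> k" "Y \<inter> {..<k} = X \<inter> {..<(k :: nat)}"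
  shows "Y \<inter> {..<j} = X \<inter> {..<j}"
proof -
  have "Y \<inter> {..<j} = (Y \<inter> {..<k}) \<inter> {..<j}" "X \<inter> {..<j} = (X \<inter> {..<k}) \<inter> {..<j}"
    using assms(1) by auto
  thus ?thesis using assms(2) by simp
qed

text \<open>Continuity on the infinite subsets of \<open>M\<close>, with values in a discrete space: near each \<open>X\<close> the
  function is determined by the elements of \<open>X\<close> below some bound.\<close>

definition cont_on_subs :: "nat set \<Rightarrow> (nat set \<Rightarrow> 'a) \<Rightarrow> bool" where
  "cont_on_subs M f \<longleftrightarrow>
     (\<forall>X\<in>subs M. \<exists>k. \<forall>Y\<in>subs M. Y \<inter> {..<k} = X \<inter> {..<k} \<longrightarrow> f Y = f X)"

lemma cont_on_subs_mono:
  assumes f: "cont_on_subs M f" and "N \<subseteq> M"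
  shows "cont_on_subs N f"
  unfolding cont_on_subs_def
proof
  fix X assume "X \<in> subs N"
  hence "X \<in> subs M" by (rule subs_mono[OF assms(2)])
  with f obtain k where k: "\<forall>Y\<in>subs M. Y \<inter> {..<k} = X \<inter> {..<k} \<longrightarrow> f Y = f X"
    unfolding cont_on_subs_def by (elim ballE) auto
  show "\<exists>k. \<forall>Y\<in>subs N. Y \<inter> {..<k} = X \<inter> {..<k} \<longrightarrow> f Y = f X"
    by (rule exI[of _ k]) (intro ballI impI k[rule_format] subs_mono[OF assms(2)], assumption+)
qed

lemma cont_on_subsD:
  assumes "cont_on_subs M f" "X \<in> subs M"
  obtains k where "\<And>j Y. k \<le> j \<Longrightarrow> Y \<in> subs M \<Longrightarrow> Y \<inter> {..<j} = X \<inter> {..<j} \<Longrightarrow> f Y = f X"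
proof -
  obtain k where k: "\<forall>Y\<in>subs M. Y \<inter> {..<k} = X \<inter> {..<k} \<longrightarrow> f Y = f X"
    using bspec[OF assms(1)[unfolded cont_on_subs_def] assms(2)] by (elim exE) (rule that)
  have agree: "Y \<inter> {..<k} = X \<inter> {..<k}" if "k \<le> j" "Y \<inter> {..<j} = X \<inter> {..<j}" for j and Y :: "nat set"
  proof -
    have "Y \<inter> {..<k} = (Y \<inter> {..<j}) \<inter> {..<k}" "X \<inter> {..<k} = (X \<inter> {..<j}) \<inter> {..<k}"
      using that(1) by auto
    thus ?thesis using that(2) by simp
  qed
  have "f Y = f X" if "k \<le> j" "Y \<in> subs M" "Y \<inter> {..<j} = X \<inter> {..<j}" for j Y
    by (rule k[rule_format, OF that(2) agree[OF that(1,3)]])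
  thus ?thesis by (rule that)
qed

lemma cont_on_subs_comp: "cont_on_subs M f \<Longrightarrow> cont_on_subs M (\<lambda>X. h (f X))"
  unfolding cont_on_subs_def by (metis (no_types))

lemma cont_on_subs_Pair:
  assumes f: "cont_on_subs M f" and g: "cont_on_subs M g"
  shows "cont_on_subs M (\<lambda>X. (f X, g X))"
  unfolding cont_on_subs_def
proof
  fix X assume X: "X \<in> subs M"
  obtain k where k: "\<And>j Y. k \<le> j \<Longrightarrow> Y \<in> subs M \<Longrightarrow> Y \<inter> {..<j} = X \<inter> {..<j} \<Longrightarrow> f Y = f X"
    using cont_on_subsD[OF f X] by metis
  obtain l where l: "\<And>j Y. l \<le> j \<Longrightarrow> Y \<in> subs M \<Longrightarrow> Y \<inter> {..<j} = X \<inter> {..<j} \<Longrightarrow> g Y = g X"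
    using cont_on_subsD[OF g X] by metis
  show "\<exists>k. \<forall>Y\<in>subs M. Y \<inter> {..<k} = X \<inter> {..<k} \<longrightarrow> (f Y, g Y) = (f X, g X)"
    by (intro exI[of _ "max k l"] ballI impI, simp only: prod.inject)
      (intro conjI k[of "max k l"] l[of "max k l"]; simp)
qed

lemma Least_in_infinite: "infinite (X :: nat set) \<Longrightarrow> (LEAST n. n \<in> X) \<in> X"
  by (metis LeastI ex_in_conv finite.emptyI)

lemma Least_agree:
  assumes "infinite X" "(LEAST n. n \<in> X) < k" "Y \<inter> {..<k} = X \<inter> {..<k}"
  shows "(LEAST n. n \<in> Y) = (LEAST n. n \<in> (X :: nat set))"
proof (rule Least_equality)
  have "(LEAST n. n \<in> X) \<in> X"
    using assms(1) by (rule Least_in_infinite)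
  thus "(LEAST n. n \<in> X) \<in> Y" using assms by blast
next
  fix y assume y: "y \<in> Y"
  show "(LEAST n. n \<in> X) \<le> y"
  proof (cases "y < k")
    case True
    hence "y \<in> X" using y assms by blast
    thus ?thesis by (rule Least_le)
  qed (use assms in auto)
qed

lemma cont_on_subs_tail:
  assumes f: "cont_on_subs M f"
  shows "cont_on_subs M (\<lambda>X. f (tail X))"
  unfolding cont_on_subs_def
proof
  fix X assume X: "X \<in> subs M"
  obtain k where k: "\<And>j Y. k \<le> j \<Longrightarrow> Y \<in> subs M \<Longrightarrow> Y \<inter> {..<j} = tail X \<inter> {..<j} \<Longrightarrow> f Y = f (tail X)"
    using cont_on_subsD[OF f tail_subs[OF X]] by metis
  define l where "l = max k (Suc (LEAST n. n \<in> X))"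
  have "f (tail Y) = f (tail X)" if Y: "Y \<in> subs M" "Y \<inter> {..<l} = X \<inter> {..<l}" for Y
  proof -
    have "(LEAST n. n \<in> Y) = (LEAST n. n \<in> X)"
      using X Y by (intro Least_agree[of X l]) (auto simp: subs_def l_def)
    hence "tail Y \<inter> {..<l} = tail X \<inter> {..<l}"
      using Y(2) by (auto simp: tail_def)
    thus ?thesis using k[of l "tail Y"] tail_subs[OF Y(1)] by (simp add: l_def)
  qed
  thus "\<exists>k. \<forall>Y\<in>subs M. Y \<inter> {..<k} = X \<inter> {..<k} \<longrightarrow> f (tail Y) = f (tail X)" by blast
qed

section \<open>The Ramsey theorem for open sets of infinite sets\<close>

text \<open>The elements of \<open>N\<close> that exceed all elements of \<open>t\<close>.\<close>

definition elems_above :: "nat set \<Rightarrow> nat set \<Rightarrow> nat set" where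
  "elems_above t N = {x \<in> N. \<forall>y\<in>t. y < x}"

lemma elems_above_empty [simp]: "elems_above {} N = N"
  by (simp add: elems_above_def)

lemma elems_above_subset: "elems_above t N \<subseteq> N"
  by (auto simp: elems_above_def)

lemma infinite_elems_above:
  assumes "infinite N" "finite t"
  shows "infinite (elems_above t N)"
proof -
  have "N \<inter> {Max (insert 0 t)<..} \<subseteq> elems_above t N"
  proof
    fix x assume x: "x \<in> N \<inter> {Max (insert 0 t)<..}"
    have "y < x" if "y \<in> t" for y
    proof -
      have "y \<le> Max (insert 0 t)" using assms(2) that by (intro Max_ge) auto
      thus ?thesis using x by simp
    qed
    thus "x \<in> elems_above t N" using x by (simp add: elems_above_def)
  qed
  thus ?thesis using infinite_Int_greaterThan[OF assms(1)] finite_subset by blast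
qed

text \<open>A property that is inherited by subsets and can always be reached by shrinking can be reached for
  finitely many indices \<open>t\<close> at once.\<close>

lemma shrink_family:
  assumes "finite T" "N \<in> subs M"
    and her: "\<And>t N N'. \<Phi> t N \<Longrightarrow> N' \<subseteq> N \<Longrightarrow> \<Phi> t N'"
    and ex: "\<And>t N'. t \<in> T \<Longrightarrow> N' \<in> subs N \<Longrightarrow> \<exists>N''\<in>subs N'. \<Phi> t N''"
  shows "\<exists>N'\<in>subs N. \<forall>t\<in>T. \<Phi> t N'"
  using assms(1,2) ex
proof (induction T)
  case empty
  thus ?case by (intro bexI[of _ N]) (auto simp: subs_def)
next
  case (insert t T)
  then obtain N1 where N1: "N1 \<in> subs N" "\<forall>t\<in>T. \<Phi> t N1" by blast
  obtain N2 where N2: "N2 \<in> subs N1" "\<Phi> t N2" using insert.prems(2)[of t N1] N1(1) by blast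
  have "\<forall>t\<in>T. \<Phi> t N2" using N1(2) N2(1) her by (auto simp: subs_def)
  moreover have "N2 \<in> subs N" using N1(1) N2(1) by (auto simp: subs_def)
  ultimately show ?case using N2(2) by blast
qed

text \<open>The diagonal construction: one infinite set \<open>N\<close> achieves \<open>\<Phi> t\<close> beyond \<open>t\<close> for each of its
  finite subsets \<open>t\<close>.  Its elements are picked one at a time, and the reservoir of the later elements
  is shrunk after each choice.\<close>

lemma finite_set_fusion:
  assumes M: "infinite M"
    and her: "\<And>t N N'. \<Phi> t N \<Longrightarrow> N' \<subseteq> N \<Longrightarrow> \<Phi> t N'"
    and ex: "\<And>t N. finite t \<Longrightarrow> t \<subseteq> M \<Longrightarrow> N \<in> subs (elems_above t M) \<Longrightarrow> \<exists>N'\<in>subs N. \<Phi> t N'"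
  shows "\<exists>N\<in>subs M. \<forall>t. finite t \<longrightarrow> t \<subseteq> N \<longrightarrow> \<Phi> t (elems_above t N)"
proof -
  \<comment> \<open>A state is the finite set \<open>s\<close> picked so far and the reservoir \<open>N\<close> of later elements.\<close>
  define R where "R = (\<lambda>(s, N). finite s \<and> s \<subseteq> M \<and> N \<in> subs (elems_above s M) \<and> (\<forall>t. t \<subseteq> s \<longrightarrow> \<Phi> t N))"
  have "\<exists>F :: nat \<Rightarrow> nat set \<times> nat set. \<forall>n. R (F n) \<and>
      (\<exists>m \<in> snd (F n). fst (F (Suc n)) = insert m (fst (F n)) \<and> snd (F (Suc n)) \<subseteq> snd (F n) \<inter> {m<..})"
  proof (rule dependent_nat_choice)
    obtain N where "N \<in> subs M" "\<Phi> {} N" using ex[of "{}" M] M by (auto simp: subs_def)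
    hence "R ({}, N)" by (simp add: R_def)
    thus "\<exists>x. R x" ..
  next
    fix x :: "nat set \<times> nat set" and n :: nat
    assume x: "R x"
    obtain s N where sN: "x = (s, N)" by fastforce
    have s: "finite s" "s \<subseteq> M" and N: "N \<in> subs (elems_above s M)" and \<Phi>: "\<And>t. t \<subseteq> s \<Longrightarrow> \<Phi> t N"
      using x by (auto simp: R_def sN)
    have infN: "infinite N" using N by (simp add: subs_def)
    then obtain m where m: "m \<in> N" using Least_in_infinite by blast
    have mM: "m \<in> M" "\<And>y. y \<in> s \<Longrightarrow> y < m" using m N by (auto simp: subs_def elems_above_def)
    define N1 where "N1 = N \<inter> {m<..}"
    have N1: "N1 \<in> subs (elems_above (insert m s) M)"
      using infinite_Int_greaterThan[OF infN, of m] N by (auto simp: N1_def subs_def elems_above_def)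
    have "\<exists>N'\<in>subs N1. \<forall>t\<in>Pow (insert m s). \<Phi> t N'"
    proof (rule shrink_family[of _ _ "elems_above (insert m s) M" \<Phi>])
      show "finite (Pow (insert m s))" using s by simp
      fix t N' assume t: "t \<in> Pow (insert m s)" and N': "N' \<in> subs N1"
      have "finite t" by (rule finite_subset[of _ "insert m s"]) (use t s in auto)
      moreover have "t \<subseteq> M" using t s mM by auto
      moreover have "N' \<in> subs (elems_above t M)" using t N' N1 by (auto simp: subs_def elems_above_def)
      ultimately show "\<exists>N''\<in>subs N'. \<Phi> t N''" by (rule ex)
    qed (use N1 her in auto)
    then obtain N' where N': "N' \<in> subs N1" "\<And>t. t \<subseteq> insert m s \<Longrightarrow> \<Phi> t N'" by blast
    have "N' \<in> subs (elems_above (insert m s) M)" using N'(1) N1 by (auto simp: subs_def)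
    hence "R (insert m s, N')" using N'(2) s mM by (simp add: R_def)
    moreover have "N' \<subseteq> N \<inter> {m<..}" using N'(1) by (simp add: subs_def N1_def)
    ultimately show "\<exists>y. R y \<and> (\<exists>m\<in>snd x. fst y = insert m (fst x) \<and> snd y \<subseteq> snd x \<inter> {m<..})"
      using m unfolding sN by (intro exI[of _ "(insert m s, N')"] conjI bexI[of _ m]) simp_all
  qed
  then obtain F :: "nat \<Rightarrow> nat set \<times> nat set" where F: "\<And>n. R (F n)"
    "\<And>n. \<exists>m \<in> snd (F n). fst (F (Suc n)) = insert m (fst (F n)) \<and> snd (F (Suc n)) \<subseteq> snd (F n) \<inter> {m<..}"
    by blast
  obtain m where m: "\<And>n. m n \<in> snd (F n)" "\<And>n. fst (F (Suc n)) = insert (m n) (fst (F n))"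
    "\<And>n. snd (F (Suc n)) \<subseteq> snd (F n) \<inter> {m n<..}" using F(2) by metis
  have FR: "snd (F n) \<subseteq> M" "\<And>t. t \<subseteq> fst (F n) \<Longrightarrow> \<Phi> t (snd (F n))" for n
    using F(1)[of n] by (auto simp: R_def subs_def elems_above_def split: prod.splits)
  have mono: "strict_mono m"
    unfolding strict_mono_Suc_iff using m(1,3) by fastforce
  have decs: "snd (F j) \<subseteq> snd (F i)" if "i \<le> j" for i j
    using that by (rule lift_Suc_antimono_le[rotated]) (use m(3) in blast)
  have early: "m j \<in> fst (F i)" if "j < i" for i j
    using that by (induction i) (auto simp: m(2) less_Suc_eq)
  have late: "m j \<in> snd (F i)" if "i \<le> j" for i j
    using m(1)[of j] decs[OF that] by blast
  have "range m \<in> subs M"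
    using m(1) FR(1) strict_mono_imp_inj_on[OF mono] by (auto simp: subs_def finite_image_iff)
  moreover have "\<Phi> t (elems_above t (range m))" if t: "finite t" "t \<subseteq> range m" for t
  proof (cases "t = {}")
    case True
    have "\<Phi> {} (snd (F 0))" by (rule FR(2)) simp
    moreover have "range m \<subseteq> snd (F 0)" using late by auto
    ultimately show ?thesis unfolding True elems_above_empty by (rule her)
  next
    case False
    then obtain i where i: "Max t = m i" using t Max_in by blast
    have "t \<subseteq> fst (F (Suc i))"
    proof
      fix x assume x: "x \<in> t"
      then obtain j where j: "x = m j" using t by blast
      have "m j \<le> m i" using x t(1) Max_ge i j by metis
      hence "j < Suc i" using strict_mono_less_eq[OF mono] by simp
      thus "x \<in> fst (F (Suc i))" using early j by blast
    qed
    hence "\<Phi> t (snd (F (Suc i)))" by (rule FR(2))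
    moreover have "elems_above t (range m) \<subseteq> snd (F (Suc i))"
    proof
      fix x assume "x \<in> elems_above t (range m)"
      then obtain j where j: "x = m j" "m i < m j" using Max_in[OF t(1) False] i by (auto simp: elems_above_def)
      hence "Suc i \<le> j" using strict_mono_less[OF mono] by simp
      thus "x \<in> snd (F (Suc i))" using late j by blast
    qed
    ultimately show ?thesis by (rule her)
  qed
  ultimately show ?thesis by blast
qed

text \<open>The proof is by combinatorial forcing: a finite set \<open>s\<close> accepts \<open>N\<close> if all \<open>s \<union> X\<close> with
  \<open>X \<subseteq> N\<close> infinite have the property, and rejects \<open>N\<close> if it accepts no infinite subset of \<open>N\<close>.\<close>

theorem open_ramsey:
  assumes M: "infinite M"
    and P: "\<And>X. X \<in> subs M \<Longrightarrow> P X \<Longrightarrow> \<exists>k. \<forall>Y\<in>subs M. Y \<inter> {..<k} = X \<inter> {..<k} \<longrightarrow> P Y"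
  shows "\<exists>N\<in>subs M. (\<forall>X\<in>subs N. P X) \<or> (\<forall>X\<in>subs N. \<not> P X)"
proof -
  define acc where "acc s N \<longleftrightarrow> (\<forall>X\<in>subs N. P (s \<union> X))" for s N
  define rej where "rej s N \<longleftrightarrow> (\<forall>N'\<in>subs N. \<not> acc s N')" for s N
  have acc_her: "acc s N'" if "acc s N" "N' \<subseteq> N" for s N N'
    using that subs_mono unfolding acc_def by blast
  have rej_her: "rej s N'" if "rej s N" "N' \<subseteq> N" for s N N'
    using that subs_mono unfolding rej_def by blast
  have notboth: "\<not> acc s N" if "rej s N" "infinite N" for s N
    using that unfolding rej_def by (auto simp: subs_def)
  \<comment> \<open>Shrink \<open>M\<close> such that each finite subset accepts or rejects.\<close>
  have "\<exists>N\<in>subs M. \<forall>t. finite t \<longrightarrow> t \<subseteq> N \<longrightarrow> acc t (elems_above t N) \<or> rej t (elems_above t N)"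
  proof (rule finite_set_fusion[OF M])
    fix t N assume N: "N \<in> subs (elems_above t M)"
    show "\<exists>N'\<in>subs N. acc t N' \<or> rej t N'"
    proof (cases "rej t N")
      case True
      thus ?thesis using N by (intro bexI[of _ N]) (auto simp: subs_def)
    next
      case False
      thus ?thesis unfolding rej_def by blast
    qed
  qed (use acc_her rej_her in blast)
  then obtain N where NM: "N \<in> subs M"
    and dec: "\<And>t. finite t \<Longrightarrow> t \<subseteq> N \<Longrightarrow> acc t (elems_above t N) \<or> rej t (elems_above t N)" by blast
  have infN: "infinite N" using NM by (simp add: subs_def)
  \<comment> \<open>Shrink further such that, if \<open>t\<close> rejects, its extensions by points of the smaller set do so.\<close>
  define \<Psi> where "\<Psi> t N' \<longleftrightarrow> (rej t (elems_above t N) \<longrightarrow> (\<forall>m\<in>N'. rej (insert m t) (elems_above (insert m t) N)))" for t N'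
  have "\<exists>N'\<in>subs N. \<forall>t. finite t \<longrightarrow> t \<subseteq> N' \<longrightarrow> \<Psi> t (elems_above t N')"
  proof (rule finite_set_fusion[OF infN])
    fix t N' assume t: "finite t" "t \<subseteq> N" and N': "N' \<in> subs (elems_above t N)"
    show "\<exists>N''\<in>subs N'. \<Psi> t N''"
    proof (cases "rej t (elems_above t N)")
      case True
      define A where "A = {m \<in> N'. acc (insert m t) (elems_above (insert m t) N)}"
      have AN: "A \<subseteq> N" "A \<subseteq> elems_above t N" using N' elems_above_subset by (auto simp: A_def subs_def)
      have "finite A"
      proof (rule ccontr)
        assume inf: "infinite A"
        \<comment> \<open>If infinitely many one-point extensions accepted, then \<open>t\<close> would accept the set of these points.\<close>
        have "P (t \<union> X)" if X: "X \<in> subs A" for X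
        proof -
          define x where "x = (LEAST n. n \<in> X)"
          have x: "x \<in> X" unfolding x_def using X by (intro Least_in_infinite) (simp add: subs_def)
          have "X - {x} \<in> subs (elems_above (insert x t) N)"
          proof -
            have "y \<in> elems_above (insert x t) N" if y: "y \<in> X" "y \<noteq> x" for y
            proof -
              have "x \<le> y" unfolding x_def using y(1) by (rule Least_le)
              moreover have "y \<in> elems_above t N" using y X AN by (auto simp: subs_def)
              ultimately show ?thesis using y by (auto simp: elems_above_def)
            qed
            thus ?thesis using X by (auto simp: subs_def)
          qed
          moreover have "acc (insert x t) (elems_above (insert x t) N)"
            using x X by (auto simp: A_def subs_def)
          ultimately have "P (insert x t \<union> (X - {x}))" unfolding acc_def by blast
          moreover have "insert x t \<union> (X - {x}) = t \<union> X" using x by auto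
          ultimately show ?thesis by simp
        qed
        hence "acc t A" by (simp add: acc_def)
        moreover have "A \<in> subs (elems_above t N)" using inf AN by (simp add: subs_def)
        ultimately show False using True by (simp add: rej_def)
      qed
      hence "N' - A \<in> subs N'" using N' by (auto simp: subs_def)
      moreover have "rej (insert m t) (elems_above (insert m t) N)" if "m \<in> N' - A" for m
        using dec[of "insert m t"] that t N' elems_above_subset[of t N] by (auto simp: A_def subs_def)
      ultimately show ?thesis unfolding \<Psi>_def by blast
    next
      case False
      thus ?thesis using N' unfolding \<Psi>_def by (intro bexI[of _ N']) (auto simp: subs_def)
    qed
  qed (auto simp: \<Psi>_def)
  then obtain N2 where N2: "N2 \<in> subs N"
    and \<Psi>: "\<And>t. finite t \<Longrightarrow> t \<subseteq> N2 \<Longrightarrow> \<Psi> t (elems_above t N2)" by blast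
  have N2M: "N2 \<subseteq> N" "N2 \<subseteq> M" "infinite N2" using N2 NM by (auto simp: subs_def)
  show ?thesis
  proof (cases "acc {} N")
    case True
    thus ?thesis using NM by (auto simp: acc_def)
  next
    case False
    hence rej0: "rej {} N" using dec[of "{}"] by simp
    \<comment> \<open>So rejection by the empty set spreads to all finite subsets of \<open>N2\<close>; but a set with the
      property has, as the property is open, a finite initial segment that accepts.\<close>
    have rej: "rej t (elems_above t N)" if "finite t" "t \<subseteq> N2" for t
      using that
    proof (induction t rule: finite_linorder_max_induct)
      case (insert m t)
      have "m \<in> elems_above t N2" using insert by (auto simp: elems_above_def)
      moreover have "\<Psi> t (elems_above t N2)" using \<Psi> insert by blast
      moreover have "rej t (elems_above t N)" using insert by blast
      ultimately show ?case unfolding \<Psi>_def by blast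
    qed (simp add: rej0)
    have "\<not> P X" if X: "X \<in> subs N2" for X
    proof
      assume PX: "P X"
      have XM: "X \<in> subs M" using X N2M by (auto simp: subs_def)
      obtain k where k: "\<And>Y. Y \<in> subs M \<Longrightarrow> Y \<inter> {..<k} = X \<inter> {..<k} \<Longrightarrow> P Y"
        using P[OF XM PX] by blast
      define t where "t = X \<inter> {..<k}"
      have t: "finite t" "t \<subseteq> N2" using X by (auto simp: t_def subs_def)
      define N3 where "N3 = elems_above t N \<inter> {k..}"
      have "N3 \<in> subs (elems_above t N)"
        using infinite_Int_atLeast[OF infinite_elems_above[OF infN t(1)]] by (simp add: N3_def subs_def)
      moreover have "acc t N3"
        unfolding acc_def
      proof
        fix Z assume Z: "Z \<in> subs N3"
        show "P (t \<union> Z)"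
        proof (rule k)
          show "t \<union> Z \<in> subs M" using Z t N2M NM by (auto simp: subs_def N3_def elems_above_def)
          have "z \<ge> k" if "z \<in> Z" for z using Z that by (auto simp: subs_def N3_def)
          thus "(t \<union> Z) \<inter> {..<k} = X \<inter> {..<k}" unfolding t_def by fastforce
        qed
      qed
      ultimately show False using rej[OF t] by (simp add: rej_def)
    qed
    moreover have "N2 \<in> subs M" using N2M by (simp add: subs_def)
    ultimately show ?thesis by blast
  qed
qed

corollary ramsey_cont:
  assumes M: "infinite M" and P: "cont_on_subs M P"
  shows "\<exists>N\<in>subs M. (\<forall>X\<in>subs N. P X) \<or> (\<forall>X\<in>subs N. \<not> P X)"
proof (rule open_ramsey[OF M])
  fix X assume X: "X \<in> subs M" and PX: "P X"
  obtain k where "\<And>j Y. k \<le> j \<Longrightarrow> Y \<in> subs M \<Longrightarrow> Y \<inter> {..<j} = X \<inter> {..<j} \<Longrightarrow> P Y = P X"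
    using cont_on_subsD[OF P X] by metis
  thus "\<exists>k. \<forall>Y\<in>subs M. Y \<inter> {..<k} = X \<inter> {..<k} \<longrightarrow> P Y" using PX by blast
qed

section \<open>Barriers and bad arrays\<close>

text \<open>Bad arrays replace bad functions on barriers: continuous functions on the infinite subsets of
  \<open>M\<close> whose value at \<open>X\<close> is never below the value at \<open>tail X\<close>.\<close>

definition bad_array :: "'a set \<Rightarrow> ('a \<Rightarrow> 'a \<Rightarrow> bool) \<Rightarrow> nat set \<Rightarrow> (nat set \<Rightarrow> 'a) \<Rightarrow> bool" where
  "bad_array C le M f \<longleftrightarrow> infinite M \<and> cont_on_subs M f \<and>
     (\<forall>X\<in>subs M. f X \<in> C \<and> \<not> le (f X) (f (tail X)))"

lemma initial_segment_iff:
  assumes "initial_segment b X" "b \<noteq> {}"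
  shows "x \<in> b \<longleftrightarrow> x \<in> X \<and> x \<le> Max b"
proof -
  have "b = {i \<in> X. i \<le> Max b}" using assms unfolding initial_segment_def by blast
  from eqset_imp_iff[OF this, of x] show ?thesis by simp
qed

lemma initial_segment_subset: "initial_segment b X \<Longrightarrow> b \<subseteq> X"
  using initial_segment_iff[of b X] by blast

lemma initial_segment_enumerate:
  assumes "initial_segment b X" "infinite X"
  shows "\<exists>n. b = enumerate X ` {..<n}"
proof (cases "b = {}")
  case False
  note b = initial_segment_iff[OF assms(1) False]
  define n where "n = (LEAST n. Max b < enumerate X n)"
  have ex: "Max b < enumerate X n"
    unfolding n_def
    by (rule LeastI[of _ "Suc (Max b)"]) (use le_enumerate[OF assms(2), of "Suc (Max b)"] in simp)
  have le: "enumerate X j \<le> Max b \<longleftrightarrow> j < n" for j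
  proof
    assume "enumerate X j \<le> Max b"
    hence "enumerate X j < enumerate X n" using ex by simp
    thus "j < n" using assms(2) by simp
  next
    assume "j < n"
    thus "enumerate X j \<le> Max b" using not_less_Least[of j "\<lambda>n. Max b < enumerate X n"]
      by (simp add: n_def)
  qed
  have "b = enumerate X ` {..<n}"
  proof (intro set_eqI iffI)
    fix x assume x: "x \<in> b"
    hence "x \<in> X" "x \<le> Max b" using b by auto
    then obtain j where "x = enumerate X j" using enumerate_Ex[OF assms(2)] by metis
    thus "x \<in> enumerate X ` {..<n}" using le \<open>x \<le> Max b\<close> by auto
  next
    fix x assume "x \<in> enumerate X ` {..<n}"
    then obtain j where "x = enumerate X j" "j < n" by auto
    hence "x \<in> X" "x \<le> Max b" using le enumerate_in_set[OF assms(2)] by auto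
    thus "x \<in> b" using b by auto
  qed
  thus ?thesis ..
qed auto

text \<open>An initial segment of \<open>X\<close> and one of \<open>tail X\<close> are in the relation \<open>\<lhd>\<close> as soon as the second is
  not contained in the first.\<close>

lemma shift_rel_segments:
  assumes X: "infinite X" and b: "initial_segment b X" and c: "initial_segment c (tail X)"
    and ne: "b \<noteq> {}" and nsub: "\<not> c \<subseteq> b"
  shows "b \<lhd> c"
proof -
  have tX: "infinite (tail X)" using X by (simp add: tail_def)
  obtain n where n: "b = enumerate X ` {..<n}" using initial_segment_enumerate[OF b X] by blast
  obtain l where l: "c = enumerate (tail X) ` {..<l}"
    using initial_segment_enumerate[OF c tX] by blast
  have e: "enumerate (tail X) j = enumerate X (Suc j)" for j by (simp add: tail_def enumerate_Suc)
  define i where "i j = enumerate X (j - 1)" for j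
  have n1: "1 \<le> n" using n ne by (cases n) auto
  have nl: "n \<le> l"
  proof (rule ccontr)
    assume "\<not> n \<le> l"
    hence "c \<subseteq> b" unfolding n l by (auto simp: e)
    thus False using nsub by simp
  qed
  have "strict_mono_on {1..Suc l} i"
    by (rule strict_mono_onI) (use X in \<open>auto simp: i_def\<close>)
  moreover have "b = i ` {1..n}"
  proof -
    have "i ` {1..n} = enumerate X ` ((\<lambda>j. j - 1) ` {1..n})" by (auto simp: i_def image_image)
    also have "(\<lambda>j. j - 1) ` {1..n} = {..<n}"
    proof (intro set_eqI iffI)
      fix j assume "j \<in> {..<n}"
      thus "j \<in> (\<lambda>j. j - 1) ` {1..n}" by (intro image_eqI[of _ _ "Suc j"]) auto
    qed auto
    finally show ?thesis using n by simp
  qed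
  moreover have "c = i ` {2..Suc l}"
  proof -
    have "{2..Suc l} = (\<lambda>j. Suc (Suc j)) ` {..<l}"
    proof (intro set_eqI iffI)
      fix j assume "j \<in> {2..Suc l}"
      thus "j \<in> (\<lambda>j. Suc (Suc j)) ` {..<l}" by (intro image_eqI[of _ _ "j - 2"]) auto
    qed auto
    thus ?thesis by (simp add: l e i_def image_image)
  qed
  ultimately show ?thesis unfolding shift_rel_def using n1 nl
    by (intro exI[of _ i] exI[of _ "Suc l"] exI[of _ n]) auto
qed

lemma barrier_nonempty:
  assumes "barrier B" "b \<in> B"
  shows "b \<noteq> {}" "finite b"
proof -
  have inf: "infinite B" and anti: "\<And>c d. c \<in> B \<Longrightarrow> d \<in> B \<Longrightarrow> c \<subseteq> d \<Longrightarrow> c = d"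
    using assms by (auto simp: barrier_def block_def)
  have "\<exists>c\<in>B. c \<noteq> b"
    using inf by (metis finite.simps subsetI finite_subset singleton_iff)
  thus "b \<noteq> {}" using anti assms(2) by blast
  show "finite b" using assms by (auto simp: barrier_def block_def)
qed

lemma bad_array_of_barrier:
  assumes B: "barrier B" and f: "f ` B \<subseteq> C" and bad: "bad_on B le f"
  shows "\<exists>M g. bad_array C le M g"
proof -
  define M where "M = \<Union>B"
  have inf: "infinite B" and anti: "\<And>c d. c \<in> B \<Longrightarrow> d \<in> B \<Longrightarrow> c \<subseteq> d \<Longrightarrow> c = d"
    and seg: "\<And>X. X \<in> subs M \<Longrightarrow> \<exists>b\<in>B. initial_segment b X"
    using B by (auto simp: barrier_def block_def M_def subs_def)
  note ne = barrier_nonempty[OF B]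
  have "infinite M"
  proof
    assume "finite M"
    hence "finite (Pow M)" by simp
    moreover have "B \<subseteq> Pow M" by (auto simp: M_def)
    ultimately show False using inf finite_subset by blast
  qed
  define \<beta> where "\<beta> X = (SOME b. b \<in> B \<and> initial_segment b X)" for X
  have \<beta>: "\<beta> X \<in> B" "initial_segment (\<beta> X) X" if "X \<in> subs M" for X
  proof -
    have "\<exists>b. b \<in> B \<and> initial_segment b X" using seg[OF that] by blast
    from someI_ex[OF this] show "\<beta> X \<in> B" "initial_segment (\<beta> X) X" by (auto simp: \<beta>_def)
  qed
  have uniq: "b = \<beta> X" if "X \<in> subs M" "b \<in> B" "initial_segment b X" for b X
  proof -
    note 1 = initial_segment_iff[OF that(3) ne(1)[OF that(2)]]
    note 2 = initial_segment_iff[OF \<beta>(2) ne(1)[OF \<beta>(1)], OF that(1) that(1)]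
    show ?thesis
    proof (cases "Max b \<le> Max (\<beta> X)")
      case True
      hence "b \<subseteq> \<beta> X" using 1 2 by (meson le_trans subsetI)
      thus ?thesis using anti \<beta>(1)[OF that(1)] that by blast
    next
      case False
      hence "\<beta> X \<subseteq> b" using 1 2 by (meson le_trans nat_le_linear subsetI)
      thus ?thesis using anti \<beta>(1)[OF that(1)] that by blast
    qed
  qed
  have "cont_on_subs M \<beta>"
    unfolding cont_on_subs_def
  proof
    fix X assume X: "X \<in> subs M"
    define k where "k = Suc (Max (\<beta> X))"
    have "\<beta> Y = \<beta> X" if Y: "Y \<in> subs M" "Y \<inter> {..<k} = X \<inter> {..<k}" for Y
    proof (rule sym, rule uniq[OF Y(1) \<beta>(1)[OF X]])
      have "x \<in> \<beta> X \<longleftrightarrow> x \<in> {i \<in> Y. i \<le> Max (\<beta> X)}" for x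
      proof -
        have "x \<in> \<beta> X \<longleftrightarrow> x \<in> X \<and> x < k"
          unfolding k_def less_Suc_eq_le
          by (rule initial_segment_iff[OF \<beta>(2)[OF X] ne(1)[OF \<beta>(1)[OF X]]])
        also have "\<dots> \<longleftrightarrow> x \<in> Y \<and> x < k" using eqset_imp_iff[OF Y(2), of x] by simp
        finally show ?thesis unfolding k_def less_Suc_eq_le by simp
      qed
      hence "\<beta> X = {i \<in> Y. i \<le> Max (\<beta> X)}" by (rule set_eqI)
      thus "initial_segment (\<beta> X) Y"
        using ne(2)[OF \<beta>(1)[OF X]] unfolding initial_segment_def by blast
    qed
    thus "\<exists>k. \<forall>Y\<in>subs M. Y \<inter> {..<k} = X \<inter> {..<k} \<longrightarrow> \<beta> Y = \<beta> X" by blast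
  qed
  hence "cont_on_subs M (\<lambda>X. f (\<beta> X))" by (rule cont_on_subs_comp)
  moreover have "f (\<beta> X) \<in> C \<and> \<not> le (f (\<beta> X)) (f (\<beta> (tail X)))" if X: "X \<in> subs M" for X
  proof -
    note bX = \<beta>[OF X] and bt = \<beta>[OF tail_subs[OF X]]
    have "(LEAST n. n \<in> X) \<in> \<beta> X"
    proof -
      note seg = initial_segment_iff[OF bX(2) ne(1)[OF bX(1)]]
      obtain y where "y \<in> \<beta> X" using ne(1)[OF bX(1)] by blast
      hence "y \<in> X" "y \<le> Max (\<beta> X)" using seg by auto
      hence "(LEAST n. n \<in> X) \<in> X" "(LEAST n. n \<in> X) \<le> Max (\<beta> X)"
        using Least_le[of "\<lambda>n. n \<in> X" y] by (auto intro: LeastI)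
      thus ?thesis using seg by simp
    qed
    moreover have "(LEAST n. n \<in> X) \<notin> \<beta> (tail X)"
      using initial_segment_subset[OF bt(2)] by (auto simp: tail_def)
    ultimately have "\<not> \<beta> (tail X) \<subseteq> \<beta> X" using anti[OF bt(1) bX(1)] by auto
    hence "\<beta> X \<lhd> \<beta> (tail X)"
      using X bX bt ne(1) by (intro shift_rel_segments[of X]) (auto simp: subs_def)
    thus ?thesis using bad bX(1) bt(1) f by (auto simp: bad_on_def)
  qed
  ultimately have "bad_array C le M (\<lambda>X. f (\<beta> X))"
    using \<open>infinite M\<close> by (simp add: bad_array_def)
  thus ?thesis by blast
qed

text \<open>The shortest nonempty initial segments that determine the value of the array form a block.  The
  Ramsey theorem turns it into a barrier: were each of them to have a proper subset of the same kind,
  their cardinalities would descend for ever, so on some \<open>N\<close> none has.\<close>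

lemma barrier_of_bad_array:
  assumes "bad_array C le M g"
  shows "\<exists>B f. barrier B \<and> f ` B \<subseteq> C \<and> bad_on B le f"
proof -
  have M: "infinite M" and cont: "cont_on_subs M g"
    and g: "\<And>X. X \<in> subs M \<Longrightarrow> g X \<in> C \<and> \<not> le (g X) (g (tail X))"
    using assms by (auto simp: bad_array_def)
  \<comment> \<open>\<open>D X e\<close>: the elements of \<open>X\<close> up to its element \<open>e\<close> determine the value of the array.\<close>
  define D where "D X e \<longleftrightarrow> e \<in> X \<and> (\<forall>Y\<in>subs M. Y \<inter> {..e} = X \<inter> {..e} \<longrightarrow> g Y = g X)" for X e
  define e where "e X = (LEAST e. D X e)" for X
  define \<beta> where "\<beta> X = X \<inter> {..e X}" for X
  have D: "D X (e X)" if X: "X \<in> subs M" for X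
  proof -
    obtain k where k: "\<And>j Y. k \<le> j \<Longrightarrow> Y \<in> subs M \<Longrightarrow> Y \<inter> {..<j} = X \<inter> {..<j} \<Longrightarrow> g Y = g X"
      using cont_on_subsD[OF cont X] by metis
    obtain x where x: "x \<in> X" "k \<le> x"
      using X infinite_nat_iff_unbounded_le[of X] by (auto simp: subs_def)
    have "D X x" unfolding D_def using x k[of "Suc x"] by (simp add: lessThan_Suc_atMost)
    thus ?thesis unfolding e_def by (rule LeastI)
  qed
  have \<beta>: "finite (\<beta> X)" "e X \<in> \<beta> X" "Max (\<beta> X) = e X" "\<beta> X \<noteq> {}" "\<beta> X \<subseteq> X" if X: "X \<in> subs M" for X
  proof -
    have "e X \<in> X" using D[OF X] by (simp add: D_def)
    thus "finite (\<beta> X)" "e X \<in> \<beta> X" "\<beta> X \<noteq> {}" "\<beta> X \<subseteq> X" by (auto simp: \<beta>_def)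
    thus "Max (\<beta> X) = e X" by (intro Max_eqI) (auto simp: \<beta>_def)
  qed
  have eq: "\<beta> Y = \<beta> X \<and> g Y = g X" if X: "X \<in> subs M" and Y: "Y \<in> subs M" and YX: "Y \<inter> {..e X} = \<beta> X" for X Y
  proof -
    have XY: "Y \<inter> {..e X} = X \<inter> {..e X}" using YX by (simp add: \<beta>_def)
    have gg: "g Y = g X" using D[OF X] Y XY by (auto simp: D_def)
    have DD: "D Y j \<longleftrightarrow> D X j" if "j \<le> e X" for j
    proof -
      have "Y \<inter> {..j} = (Y \<inter> {..e X}) \<inter> {..j}" "X \<inter> {..j} = (X \<inter> {..e X}) \<inter> {..j}"
        using that by auto
      hence "Y \<inter> {..j} = X \<inter> {..j}" using XY by simp
      moreover have "j \<in> Y \<longleftrightarrow> j \<in> X" using calculation by auto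
      ultimately show ?thesis unfolding D_def gg by simp
    qed
    have "e Y = e X"
      unfolding e_def[of Y]
    proof (rule Least_equality)
      show "D Y (e X)" using DD D[OF X] by simp
      fix j assume j: "D Y j"
      show "e X \<le> j"
      proof (rule ccontr)
        assume "\<not> e X \<le> j"
        hence "D X j" "j < e X" using DD[of j] j by auto
        thus False using not_less_Least[of j "D X"] by (simp add: e_def)
      qed
    qed
    thus ?thesis using XY gg by (simp add: \<beta>_def)
  qed
  have cont\<beta>: "cont_on_subs M \<beta>"
    unfolding cont_on_subs_def
  proof
    fix X assume X: "X \<in> subs M"
    have "\<beta> Y = \<beta> X" if Y: "Y \<in> subs M" "Y \<inter> {..<Suc (e X)} = X \<inter> {..<Suc (e X)}" for Y
      using eq[OF X Y(1)] Y(2) by (simp add: \<beta>_def lessThan_Suc_atMost)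
    thus "\<exists>k. \<forall>Y\<in>subs M. Y \<inter> {..<k} = X \<inter> {..<k} \<longrightarrow> \<beta> Y = \<beta> X" by blast
  qed
  define P where "P b \<longleftrightarrow> (\<exists>c\<in>\<beta> ` subs M. c \<subset> b)" for b
  obtain N where N: "N \<in> subs M" "(\<forall>X\<in>subs N. P (\<beta> X)) \<or> (\<forall>X\<in>subs N. \<not> P (\<beta> X))"
    using ramsey_cont[OF M cont_on_subs_comp[OF cont\<beta>, of P]] by blast
  have NM: "N \<subseteq> M" "infinite N" using N by (auto simp: subs_def)
  note sNM = subs_mono[OF NM(1)]
  have realised: "\<exists>Y\<in>subs N. \<beta> Y = \<beta> X" if X: "X \<in> subs M" "\<beta> X \<subseteq> N" for X
  proof
    define Y where "Y = \<beta> X \<union> (N \<inter> {e X<..})"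
    show Y: "Y \<in> subs N" using infinite_Int_greaterThan[OF NM(2)] X(2) by (auto simp: subs_def Y_def)
    have "Y \<inter> {..e X} = \<beta> X" by (auto simp: Y_def \<beta>_def)
    thus "\<beta> Y = \<beta> X" using eq[OF X(1) sNM[OF Y]] by simp
  qed
  have no: "\<not> P (\<beta> X)" if "X \<in> subs N" for X
  proof -
    have "\<not> (\<forall>X\<in>subs N. P (\<beta> X))"
    proof
      assume all: "\<forall>X\<in>subs N. P (\<beta> X)"
      have "\<forall>X\<in>subs N. card (\<beta> X) \<noteq> n" for n
      proof (induction n rule: less_induct)
        case (less n)
        show ?case
        proof
          fix X assume X: "X \<in> subs N"
          hence "P (\<beta> X)" using all by blast
          then obtain X' where X': "X' \<in> subs M" "\<beta> X' \<subset> \<beta> X" unfolding P_def by blast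
          have "\<beta> X' \<subseteq> N" using X' \<beta>(5)[OF sNM[OF X]] X by (auto simp: subs_def)
          then obtain Y where Y: "Y \<in> subs N" "\<beta> Y = \<beta> X'" using realised X'(1) by blast
          have "card (\<beta> Y) < card (\<beta> X)"
            using X'(2) Y(2) \<beta>(1)[OF sNM[OF X]] psubset_card_mono by metis
          thus "card (\<beta> X) \<noteq> n" using less Y(1) by blast
        qed
      qed
      moreover have "N \<in> subs N" using NM by (simp add: subs_def)
      ultimately show False by blast
    qed
    thus ?thesis using N(2) that by blast
  qed
  define B where "B = \<beta> ` subs N"
  define f where "f b = g (SOME X. X \<in> subs N \<and> \<beta> X = b)" for b
  have fg: "f (\<beta> X) = g X" if X: "X \<in> subs N" for X
  proof -
    define Y where "Y = (SOME Y. Y \<in> subs N \<and> \<beta> Y = \<beta> X)"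
    have "Y \<in> subs N \<and> \<beta> Y = \<beta> X" unfolding Y_def by (rule someI[of _ X]) (use X in simp)
    moreover have "Y \<inter> {..e X} = \<beta> X" if "\<beta> Y = \<beta> X" "Y \<in> subs N"
      using that \<beta>(3)[OF sNM[OF X]] \<beta>(3)[OF sNM[OF that(2)]] by (simp add: \<beta>_def)
    ultimately have "g Y = g X" using eq[OF sNM[OF X], of Y] sNM by blast
    thus ?thesis by (simp add: f_def Y_def)
  qed
  have UB: "\<Union>B = N"
  proof
    show "\<Union>B \<subseteq> N"
    proof
      fix x assume "x \<in> \<Union>B"
      then obtain X where X: "X \<in> subs N" "x \<in> \<beta> X" unfolding B_def by blast
      hence "x \<in> X" using \<beta>(5)[OF sNM[OF X(1)]] by blast
      thus "x \<in> N" using X(1) by (auto simp: subs_def)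
    qed
    show "N \<subseteq> \<Union>B"
    proof
      fix n assume n: "n \<in> N"
      define X where "X = N \<inter> {n..}"
      have X: "X \<in> subs N" using infinite_Int_atLeast[OF NM(2)] by (simp add: X_def subs_def)
      have "e X \<in> X" using \<beta>(2,5)[OF sNM[OF X]] by blast
      hence "n \<in> \<beta> X" using n by (auto simp: \<beta>_def X_def)
      thus "n \<in> \<Union>B" using X by (auto simp: B_def)
    qed
  qed
  have fin: "finite b" if "b \<in> B" for b using that \<beta>(1)[OF sNM] unfolding B_def by blast
  have "infinite B"
  proof
    assume "finite B"
    hence "finite (\<Union>B)" using fin by blast
    thus False using UB NM by simp
  qed
  moreover have "\<exists>b\<in>B. initial_segment b X" if "infinite X" "X \<subseteq> \<Union>B" for X
  proof
    have X: "X \<in> subs N" using that UB by (simp add: subs_def)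
    thus "\<beta> X \<in> B" by (simp add: B_def)
    show "initial_segment (\<beta> X) X"
      unfolding initial_segment_def \<beta>(3)[OF sNM[OF X]]
      using \<beta>(1)[OF sNM[OF X]] by (auto simp: \<beta>_def)
  qed
  moreover have sub: "b = c" if "b \<in> B" "c \<in> B" "b \<subseteq> c" for b c
  proof (rule ccontr)
    assume "b \<noteq> c"
    hence "b \<subset> c" using that by auto
    moreover obtain X where "X \<in> subs N" "c = \<beta> X" using \<open>c \<in> B\<close> unfolding B_def by blast
    moreover have "b \<in> \<beta> ` subs M" using that(1) sNM unfolding B_def by blast
    ultimately show False using no[of X] unfolding P_def by blast
  qed
  ultimately have "barrier B" using fin unfolding barrier_def block_def by blast
  moreover have "f ` B \<subseteq> C" using fg g[OF sNM] unfolding B_def by auto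
  moreover have "bad_on B le f"
    unfolding bad_on_def
  proof (intro ballI impI)
    fix b c assume b: "b \<in> B" and c: "c \<in> B" and bc: "b \<lhd> c"
    obtain i :: "nat \<Rightarrow> nat" and m k where i: "strict_mono_on {1..m} i" "1 \<le> k" "k < m"
      "b = i ` {1..k}" "c = i ` {2..m}" using bc by (auto simp: shift_rel_def)
    have lt: "i x < i y" if "x < y" "1 \<le> x" "y \<le> m" for x y
      using strict_mono_onD[OF i(1)] that by auto
    define Z where "Z = c \<union> (N \<inter> {i m<..})"
    define X where "X = insert (i 1) Z"
    have bcN: "b \<subseteq> N" "c \<subseteq> N" using b c UB by auto
    have Z: "Z \<in> subs N"
      using bcN infinite_Int_greaterThan[OF NM(2)] by (auto simp: subs_def Z_def)
    have "i 1 \<in> N" using bcN i by auto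
    hence X: "X \<in> subs N" using Z by (auto simp: X_def subs_def)
    have i1: "i 1 < z" if "z \<in> Z" for z
    proof -
      have "i 1 < i m" using lt i by auto
      thus ?thesis using that lt[of 1] by (auto simp: Z_def i(5))
    qed
    have "(LEAST n. n \<in> X) = i 1"
      by (rule Least_equality) (use i1 in \<open>auto simp: X_def less_imp_le\<close>)
    hence tX: "tail X = Z" using i1 by (auto simp: tail_def X_def)
    have seg: "\<beta> Y = d" if d: "d \<in> B" and Y: "Y \<in> subs N" and Yd: "Y \<inter> {..Max d} = d" for Y d
    proof -
      obtain W where W: "W \<in> subs N" "d = \<beta> W" using d by (auto simp: B_def)
      have "Max d = e W" using \<beta>(3)[OF sNM[OF W(1)]] W(2) by simp
      thus ?thesis using eq[OF sNM[OF W(1)] sNM[OF Y]] Yd W(2) by simp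
    qed
    have mb: "Max b = i k"
      unfolding i(4)
    proof (rule Max_eqI)
      fix y assume "y \<in> i ` {1..k}"
      then obtain j where "y = i j" "j \<in> {1..k}" by auto
      thus "y \<le> i k" using lt[of j k] i by (cases "j = k") (auto simp: less_imp_le)
    qed (use i in auto)
    have mc: "Max c = i m"
      unfolding i(5)
    proof (rule Max_eqI)
      fix y assume "y \<in> i ` {2..m}"
      then obtain j where "y = i j" "j \<in> {2..m}" by auto
      thus "y \<le> i m" using lt[of j m] i by (cases "j = m") (auto simp: less_imp_le)
    qed (use i in auto)
    have "\<beta> Z = c"
    proof (rule seg[OF c Z])
      have "y \<le> i m" if "y \<in> c" for y using that mc fin[OF c] Max_ge by metis
      thus "Z \<inter> {..Max c} = c" unfolding mc by (auto simp: Z_def)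
    qed
    moreover have "\<beta> X = b"
    proof (rule seg[OF b X])
      have "X \<inter> {..i k} = b"
      proof (intro set_eqI iffI)
        fix y assume y: "y \<in> X \<inter> {..i k}"
        have "i k < i m" using lt i by auto
        with y consider "y = i 1" | j where "y = i j" "j \<in> {2..m}" by (auto simp: X_def Z_def i(5))
        thus "y \<in> b"
        proof cases
          case 2
          have "j \<le> k"
          proof (rule ccontr)
            assume "\<not> j \<le> k"
            hence "i k < i j" using lt[of k j] i 2 by auto
            thus False using y 2 by auto
          qed
          thus ?thesis using 2 by (auto simp: i(4))
        qed (use i in auto)
      next
        fix y assume y: "y \<in> b"
        hence "y \<le> i k" using mb fin[OF b] Max_ge by metis
        moreover obtain j where "y = i j" "j \<in> {1..k}" using y i(4) by auto
        hence "y \<in> X" using i(3) by (cases "j = 1") (auto simp: X_def Z_def i(5))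
        ultimately show "y \<in> X \<inter> {..i k}" by simp
      qed
      thus "X \<inter> {..Max b} = b" by (simp add: mb)
    qed
    ultimately show "\<not> le (f b) (f c)"
      using fg[OF X] fg[OF Z] g[OF sNM[OF X]] tX by auto
  qed
  ultimately show ?thesis by blast
qed

lemma bqo_on_iff_arrays:
  "bqo_on Q le \<longleftrightarrow> quasi_order_on Q le \<and> (\<nexists>M f. bad_array Q le M f)"
  unfolding bqo_on_def by (metis bad_array_of_barrier barrier_of_bad_array)

section \<open>Minimal bad arrays\<close>

text \<open>A pointwise limit of continuous functions in which every sequence of values is eventually constant
  becomes continuous on some infinite \<open>N\<close>.  The set of those \<open>X\<close> at which the values still change after
  stage \<open>n\<close> is open, so the Ramsey theorem applies to it beyond every finite set \<open>t\<close>, with the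
  stage \<open>n = Max t\<close>.\<close>

lemma cont_on_subs_limit:
  fixes F :: "nat \<Rightarrow> nat set \<Rightarrow> 'a"
  assumes M: "infinite M" and cont: "\<And>n. cont_on_subs M (F n)"
    and lim: "\<And>X n. X \<in> subs M \<Longrightarrow> st X \<le> n \<Longrightarrow> F n X = f X"
  shows "\<exists>N\<in>subs M. cont_on_subs N f"
proof -
  \<comment> \<open>At \<open>X\<close> the values still change after stage \<open>n\<close>.\<close>
  define D where "D n X \<longleftrightarrow> (\<exists>m\<ge>n. F m X \<noteq> F n X)" for n X
  \<comment> \<open>The element \<open>0\<close> is inserted only to give the empty set a maximum.\<close>
  define \<Phi> where "\<Phi> t N \<longleftrightarrow> (\<forall>X\<in>subs N. D (Max (insert 0 t)) (t \<union> X)) \<or> (\<forall>X\<in>subs N. \<not> D (Max (insert 0 t)) (t \<union> X))" for t N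
  have "\<exists>N\<in>subs M. \<forall>t. finite t \<longrightarrow> t \<subseteq> N \<longrightarrow> \<Phi> t (elems_above t N)"
  proof (rule finite_set_fusion[OF M])
    fix t N assume t: "finite t" "t \<subseteq> M" and N: "N \<in> subs (elems_above t M)"
    define n where "n = Max (insert 0 t)"
    have NM: "N \<subseteq> M" "infinite N" using N elems_above_subset by (auto simp: subs_def)
    show "\<exists>N'\<in>subs N. \<Phi> t N'"
      unfolding \<Phi>_def n_def[symmetric]
    proof (rule open_ramsey[OF NM(2)])
      fix X assume X: "X \<in> subs N" and DX: "D n (t \<union> X)"
      then obtain m where m: "n \<le> m" "F m (t \<union> X) \<noteq> F n (t \<union> X)" by (auto simp: D_def)
      have tX: "t \<union> Z \<in> subs M" if "Z \<in> subs N" for Z using that NM t by (auto simp: subs_def)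
      obtain k where k: "\<And>j Y. k \<le> j \<Longrightarrow> Y \<in> subs M \<Longrightarrow> Y \<inter> {..<j} = (t \<union> X) \<inter> {..<j} \<Longrightarrow>
          (F m Y, F n Y) = (F m (t \<union> X), F n (t \<union> X))"
        using cont_on_subsD[OF cont_on_subs_Pair[OF cont[of m] cont[of n]] tX[OF X]] by metis
      have "D n (t \<union> Y)" if Y: "Y \<in> subs N" "Y \<inter> {..<k} = X \<inter> {..<k}" for Y
      proof -
        have "(t \<union> Y) \<inter> {..<k} = (t \<union> X) \<inter> {..<k}" using Y(2) by (simp add: Int_Un_distrib2)
        hence "F m (t \<union> Y) \<noteq> F n (t \<union> Y)" using k[OF order_refl tX[OF Y(1)]] m(2) by simp
        thus ?thesis unfolding D_def using m(1) by blast
      qed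
      thus "\<exists>k. \<forall>Y\<in>subs N. Y \<inter> {..<k} = X \<inter> {..<k} \<longrightarrow> D n (t \<union> Y)" by blast
    qed
  next
    fix t N N' assume "\<Phi> t N" "N' \<subseteq> N"
    thus "\<Phi> t N'" unfolding \<Phi>_def using subs_mono by blast
  qed
  then obtain N where N: "N \<in> subs M" and \<Phi>: "\<And>t. finite t \<Longrightarrow> t \<subseteq> N \<Longrightarrow> \<Phi> t (elems_above t N)" by blast
  have sNM: "Y \<in> subs M" if "Y \<in> subs N" for Y using that N by (auto simp: subs_def)
  have "cont_on_subs N f"
    unfolding cont_on_subs_def
  proof
    fix X assume X: "X \<in> subs N"
    obtain x where x: "x \<in> X" "st X \<le> x"
      using X infinite_nat_iff_unbounded_le[of X] unfolding subs_def by blast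
    define t where "t = X \<inter> {..<Suc x}"
    have t: "finite t" "t \<subseteq> N" using X by (auto simp: t_def subs_def)
    have mx: "Max (insert 0 t) = x" by (rule Max_eqI) (use x in \<open>auto simp: t_def\<close>)
    have split: "\<exists>Z\<in>subs (elems_above t N). Y = t \<union> Z"
      if Y: "Y \<in> subs N" "Y \<inter> {..<Suc x} = X \<inter> {..<Suc x}" for Y
    proof
      have "Y = (Y \<inter> {..<Suc x}) \<union> (Y \<inter> {x<..})" by auto
      thus "Y = t \<union> (Y \<inter> {x<..})" unfolding Y(2) t_def[symmetric] .
      show "Y \<inter> {x<..} \<in> subs (elems_above t N)"
        using Y(1) infinite_Int_greaterThan[of Y x] by (auto simp: subs_def elems_above_def t_def)
    qed
    have "\<not> D x X" unfolding D_def using lim[OF sNM[OF X]] x by auto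
    moreover obtain Z where Z: "Z \<in> subs (elems_above t N)" "X = t \<union> Z" using split[OF X] by blast
    ultimately have "\<not> (\<forall>X\<in>subs (elems_above t N). D x (t \<union> X))" by metis
    hence noD: "\<not> D x (t \<union> Z)" if "Z \<in> subs (elems_above t N)" for Z
      using \<Phi>[OF t] that unfolding \<Phi>_def mx by blast
    have fF: "f Y = F x Y" if Y: "Y \<in> subs N" "Y \<inter> {..<Suc x} = X \<inter> {..<Suc x}" for Y
    proof -
      have "\<not> D x Y" using split[OF Y] noD by blast
      hence "F (max x (st Y)) Y = F x Y" unfolding D_def by (meson max.cobounded1)
      thus ?thesis using lim[OF sNM[OF Y(1)], of "max x (st Y)"] by simp
    qed
    obtain k where k: "\<And>j Y. k \<le> j \<Longrightarrow> Y \<in> subs M \<Longrightarrow> Y \<inter> {..<j} = X \<inter> {..<j} \<Longrightarrow> F x Y = F x X"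
      using cont_on_subsD[OF cont sNM[OF X]] by metis
    have "f Y = f X" if Y: "Y \<in> subs N" "Y \<inter> {..<max k (Suc x)} = X \<inter> {..<max k (Suc x)}" for Y
    proof -
      have "F x Y = F x X" using k[OF _ sNM[OF Y(1)] Y(2)] by simp
      moreover have "f Y = F x Y" by (rule fF[OF Y(1) agree_le[OF _ Y(2)]]) simp
      ultimately show ?thesis using fF[OF X refl] by simp
    qed
    thus "\<exists>k. \<forall>Y\<in>subs N. Y \<inter> {..<k} = X \<inter> {..<k} \<longrightarrow> f Y = f X" by blast
  qed
  thus ?thesis using N by blast
qed

text \<open>A pair \<open>(M, f)\<close> stands for a function \<open>f\<close> on the infinite subsets of \<open>M\<close>.  It is refined by
  passing to a subset of \<open>M\<close> and to values that are pointwise smaller or equal.\<close>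

definition refines ::
  "('a \<Rightarrow> 'a \<Rightarrow> bool) \<Rightarrow> nat set \<times> (nat set \<Rightarrow> 'a) \<Rightarrow> nat set \<times> (nat set \<Rightarrow> 'a) \<Rightarrow> bool" where
  "refines lt G F \<longleftrightarrow> fst G \<subseteq> fst F \<and> (\<forall>X\<in>subs (fst G). lt (snd G X) (snd F X) \<or> snd G X = snd F X)"

text \<open>The function has the constant value \<open>v\<close> on the infinite sets that agree with \<open>t\<close> below \<open>a\<close>, and
  there are such sets.\<close>

definition const_at :: "nat \<Rightarrow> nat set \<Rightarrow> 'a \<Rightarrow> nat set \<times> (nat set \<Rightarrow> 'a) \<Rightarrow> bool" where
  "const_at a t v F \<longleftrightarrow> (\<exists>X\<in>subs (fst F). X \<inter> {..<a} = t) \<and>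
     (\<forall>X\<in>subs (fst F). X \<inter> {..<a} = t \<longrightarrow> snd F X = v)"

text \<open>One step of the construction of a minimal bad array, devoted to the finite set \<open>t\<close>: the part of
  the domain below \<open>a\<close> is kept, the domain has an element between \<open>a\<close> and the new bound \<open>a'\<close>, and
  among all refinements by bad arrays that are constant at \<open>t\<close> and keep the part below \<open>a\<close>, the chosen
  one has a minimal constant value at \<open>t\<close>.  If there are no such refinements, the last requirement
  is void.\<close>

definition fusion_step ::
  "'a set \<Rightarrow> ('a \<Rightarrow> 'a \<Rightarrow> bool) \<Rightarrow> ('a \<Rightarrow> 'a \<Rightarrow> bool) \<Rightarrow> nat set \<Rightarrow> nat set \<times> (nat set \<Rightarrow> 'a) \<Rightarrow> nat
     \<Rightarrow> nat set \<times> (nat set \<Rightarrow> 'a) \<Rightarrow> nat \<Rightarrow> bool" where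
  "fusion_step C le lt t F a F' a' \<longleftrightarrow>
     refines lt F' F \<and> fst F' \<inter> {..<a} = fst F \<inter> {..<a} \<and> a < a' \<and> fst F' \<inter> {a..<a'} \<noteq> {} \<and>
     (\<forall>G v. bad_array C le (fst G) (snd G) \<longrightarrow> refines lt G F \<longrightarrow> fst G \<inter> {..<a} = fst F \<inter> {..<a} \<longrightarrow>
        const_at a t v G \<longrightarrow> (\<exists>v'. const_at a t v' F' \<and> \<not> lt v v'))"

lemma wfp_minimal:
  assumes "wfp lt" "S \<noteq> {}"
  shows "\<exists>v\<in>S. \<forall>w\<in>S. \<not> lt w v"
  using assms unfolding wfp_iff_ex_minimal by meson

lemma refines_refl: "refines lt F F"
  by (simp add: refines_def)

lemma refines_trans:
  assumes "transp lt" "refines lt H G" "refines lt G F"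
  shows "refines lt H F"
  unfolding refines_def
proof (intro conjI ballI)
  show "fst H \<subseteq> fst F" using assms(2,3) by (auto simp: refines_def)
  fix X assume X: "X \<in> subs (fst H)"
  hence "X \<in> subs (fst G)" using assms(2) by (auto simp: refines_def subs_def)
  hence "lt (snd G X) (snd F X) \<or> snd G X = snd F X" "lt (snd H X) (snd G X) \<or> snd H X = snd G X"
    using assms(2,3) X unfolding refines_def by blast+
  thus "lt (snd H X) (snd F X) \<or> snd H X = snd F X"
    using transpD[OF assms(1), of "snd H X" "snd G X" "snd F X"] by (elim disjE) simp_all
qed

lemma fusion_step_exists:
  assumes wf: "wfp lt" and F: "bad_array C le (fst F) (snd F)"
  shows "\<exists>F' a'. bad_array C le (fst F') (snd F') \<and> fusion_step C le lt t F a F' a'"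
proof -
  define S where "S = {v. \<exists>G. bad_array C le (fst G) (snd G) \<and> refines lt G F \<and>
    fst G \<inter> {..<a} = fst F \<inter> {..<a} \<and> const_at a t v G}"
  have "\<exists>F'. bad_array C le (fst F') (snd F') \<and> refines lt F' F \<and> fst F' \<inter> {..<a} = fst F \<inter> {..<a} \<and>
     (\<forall>v\<in>S. (\<exists>v'. const_at a t v' F' \<and> \<not> lt v v'))"
  proof (cases "S = {}")
    case True
    thus ?thesis using F refines_refl[of lt F] by (intro exI[of _ F]) simp
  next
    case False
    from wfp_minimal[OF wf this] obtain v where v: "v \<in> S" "\<And>w. w \<in> S \<Longrightarrow> \<not> lt w v" by metis
    then obtain G where "bad_array C le (fst G) (snd G)" "refines lt G F"
      "fst G \<inter> {..<a} = fst F \<inter> {..<a}" "const_at a t v G" unfolding S_def by blast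
    thus ?thesis using v(2) by blast
  qed
  then obtain F' where F': "bad_array C le (fst F') (snd F')" "refines lt F' F" "fst F' \<inter> {..<a} = fst F \<inter> {..<a}"
     "\<And>v. v \<in> S \<Longrightarrow> \<exists>v'. const_at a t v' F' \<and> \<not> lt v v'" by blast
  have "infinite (fst F')" using F'(1) by (simp add: bad_array_def)
  then obtain m where m: "m \<in> fst F'" "a \<le> m" using infinite_nat_iff_unbounded_le by blast
  have "fusion_step C le lt t F a F' (Suc m)"
    unfolding fusion_step_def
  proof (intro conjI allI impI)
    show "fst F' \<inter> {a..<Suc m} \<noteq> {}" using m by auto
    fix G v assume "bad_array C le (fst G) (snd G)" "refines lt G F"
      "fst G \<inter> {..<a} = fst F \<inter> {..<a}" "const_at a t v G"
    hence "v \<in> S" unfolding S_def by blast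
    thus "\<exists>v'. const_at a t v' F' \<and> \<not> lt v v'" by (rule F'(4))
  qed (use F'(2,3) m in simp_all)
  thus ?thesis using F'(1) by blast
qed

text \<open>The minimal bad array is the limit of a sequence of refinements, restricted to a set on which
  the limit is continuous; in this sequence every finite set \<open>t\<close> gets its turn arbitrarily late.  Suppose that a bad array \<open>g\<close> on \<open>K\<close> lies strictly below the limit.
  The value \<open>g K\<close> is determined by a finite initial segment \<open>t\<close> of \<open>K\<close>.  At a late enough turn of \<open>t\<close>
  the array current at that time could have been replaced by \<open>g\<close> on the subsets of \<open>K\<close>, which would
  have made the value at \<open>t\<close> strictly smaller than the minimal one chosen.\<close>

theorem minimal_bad_array:
  fixes le lt :: "'a \<Rightarrow> 'a \<Rightarrow> bool"
  assumes bad: "bad_array C le M0 f0" and wf: "wfp lt" and tr: "transp lt"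
    and lt_le: "\<And>x y. lt x y \<Longrightarrow> le x y" and le_tr: "transp_on C le"
  shows "\<exists>M f. bad_array C le M f \<and>
    (\<forall>N g. N \<subseteq> M \<longrightarrow> bad_array C le N g \<longrightarrow> (\<exists>X\<in>subs N. \<not> lt (g X) (f X)))"
proof -
  \<comment> \<open>Stage \<open>n\<close> is devoted to the finite set coded by the first component of \<open>n\<close>; the second component
    makes each finite set occur infinitely often.\<close>
  define t where "t n = set_decode (fst (prod_decode n))" for n
  have "\<exists>S :: nat \<Rightarrow> (nat set \<times> (nat set \<Rightarrow> 'a)) \<times> nat. \<forall>n. bad_array C le (fst (fst (S n))) (snd (fst (S n))) \<and>
     fusion_step C le lt (t n) (fst (S n)) (snd (S n)) (fst (S (Suc n))) (snd (S (Suc n)))"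
  proof (rule dependent_nat_choice)
    show "\<exists>s :: (nat set \<times> (nat set \<Rightarrow> 'a)) \<times> nat. bad_array C le (fst (fst s)) (snd (fst s))"
      using bad by (intro exI[of _ "((M0, f0), 0)"]) simp
    fix s :: "(nat set \<times> (nat set \<Rightarrow> 'a)) \<times> nat" and n
    assume "bad_array C le (fst (fst s)) (snd (fst s))"
    from fusion_step_exists[OF wf this, of "t n" "snd s"] obtain F' a'
      where "bad_array C le (fst F') (snd F')" "fusion_step C le lt (t n) (fst s) (snd s) F' a'" by blast
    thus "\<exists>y. bad_array C le (fst (fst y)) (snd (fst y)) \<and> fusion_step C le lt (t n) (fst s) (snd s) (fst y) (snd y)"
      by (intro exI[of _ "(F', a')"]) simp
  qed
  then obtain S where S: "\<And>n. bad_array C le (fst (fst (S n))) (snd (fst (S n)))"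
    "\<And>n. fusion_step C le lt (t n) (fst (S n)) (snd (S n)) (fst (S (Suc n))) (snd (S (Suc n)))" by blast
  define F where "F n = fst (S n)" for n
  define a where "a n = snd (S n)" for n
  have badF: "bad_array C le (fst (F n)) (snd (F n))"
    and stp: "fusion_step C le lt (t n) (F n) (a n) (F (Suc n)) (a (Suc n))" for n
    using S unfolding F_def a_def by blast+
  have ref1: "refines lt (F (Suc n)) (F n)" and fix1: "fst (F (Suc n)) \<inter> {..<a n} = fst (F n) \<inter> {..<a n}"
    and a1: "a n < a (Suc n)" and ne1: "fst (F (Suc n)) \<inter> {a n..<a (Suc n)} \<noteq> {}"
    and min1: "\<And>G v. bad_array C le (fst G) (snd G) \<Longrightarrow> refines lt G (F n) \<Longrightarrow>
       fst G \<inter> {..<a n} = fst (F n) \<inter> {..<a n} \<Longrightarrow>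
       const_at (a n) (t n) v G \<Longrightarrow> \<exists>v'. const_at (a n) (t n) v' (F (Suc n)) \<and> \<not> lt v v'"
    for n using stp[of n] unfolding fusion_step_def by blast+
  have amono: "strict_mono a" using a1 by (simp add: strict_mono_Suc_iff)
  have ale: "n \<le> a n" for n using strict_mono_imp_increasing[OF amono] .
  have ref: "refines lt (F j) (F i)" if "i \<le> j" for i j
    using that
  proof (induction j rule: dec_induct)
    case base show ?case by (rule refines_refl)
  next
    case (step j) thus ?case using refines_trans[OF tr ref1] by blast
  qed
  have fixd: "fst (F j) \<inter> {..<a i} = fst (F i) \<inter> {..<a i}" if "i \<le> j" for i j
    using that
  proof (induction j rule: dec_induct)
    case (step j)
    have "a i \<le> a j" using step(1) strict_mono_less_eq[OF amono] by simp
    from agree_le[OF this fix1] show ?case using step by simp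
  qed auto
  define M where "M = (\<Inter>n. fst (F n))"
  have MF: "M \<subseteq> fst (F n)" for n by (auto simp: M_def)
  note sMF = subs_mono[OF MF]
  have Mfix: "M \<inter> {..<a i} = fst (F i) \<inter> {..<a i}" for i
  proof
    show "fst (F i) \<inter> {..<a i} \<subseteq> M \<inter> {..<a i}"
    proof
      fix x assume x: "x \<in> fst (F i) \<inter> {..<a i}"
      have "x \<in> fst (F j)" for j
      proof (cases "i \<le> j")
        case True thus ?thesis using fixd[OF True] x by blast
      next
        case False thus ?thesis using ref[of j i] x by (auto simp: refines_def)
      qed
      thus "x \<in> M \<inter> {..<a i}" using x by (simp add: M_def)
    qed
  qed (use MF in auto)
  have infM: "infinite M"
    unfolding infinite_nat_iff_unbounded_le
  proof
    fix n
    obtain x where x: "x \<in> fst (F (Suc n))" "a n \<le> x" "x < a (Suc n)" using ne1[of n] by auto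
    have "x \<in> M \<inter> {..<a (Suc n)}" unfolding Mfix using x by simp
    moreover have "n \<le> x" using x(2) ale[of n] by simp
    ultimately show "\<exists>x\<ge>n. x \<in> M" by blast
  qed
  \<comment> \<open>The values at \<open>X\<close> descend along a well-founded relation, so they become constant.\<close>
  have stab: "\<exists>i. \<forall>j\<ge>i. snd (F j) X = snd (F i) X" if X: "X \<in> subs M" for X
  proof -
    define V where "V = range (\<lambda>n. snd (F n) X)"
    have "V \<noteq> {}" by (simp add: V_def)
    from wfp_minimal[OF wf this] obtain v where v: "v \<in> V" "\<And>w. w \<in> V \<Longrightarrow> \<not> lt w v" by metis
    from v(1) obtain i where i: "v = snd (F i) X" by (auto simp: V_def)
    have "snd (F j) X = snd (F i) X" if "i \<le> j" for j
    proof -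
      have "\<not> lt (snd (F j) X) (snd (F i) X)" using v(2)[of "snd (F j) X"] by (simp add: V_def i)
      thus ?thesis using ref[OF that] sMF[OF X, of j] unfolding refines_def by blast
    qed
    thus ?thesis by blast
  qed
  define st where "st X = (SOME i. \<forall>j\<ge>i. snd (F j) X = snd (F i) X)" for X
  define f where "f X = snd (F (st X)) X" for X
  have lim: "snd (F j) X = f X" if "X \<in> subs M" "st X \<le> j" for X j
    using someI_ex[OF stab[OF that(1)]] that(2) unfolding st_def f_def by blast
  have fC: "f X \<in> C \<and> \<not> le (f X) (f (tail X))" if X: "X \<in> subs M" for X
  proof -
    define j where "j = max (st X) (st (tail X))"
    have "snd (F j) X \<in> C \<and> \<not> le (snd (F j) X) (snd (F j) (tail X))"
      using badF[of j] sMF[OF X] by (auto simp: bad_array_def)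
    thus ?thesis using lim[OF X, of j] lim[OF tail_subs[OF X], of j] by (simp add: j_def)
  qed
  have flt: "lt (f X) (snd (F n) X) \<or> f X = snd (F n) X" if X: "X \<in> subs M" for X n
  proof -
    define j where "j = max n (st X)"
    have "lt (snd (F j) X) (snd (F n) X) \<or> snd (F j) X = snd (F n) X"
      using ref[of n j] sMF[OF X, of j] by (auto simp: refines_def j_def)
    thus ?thesis using lim[OF X, of j] by (simp add: j_def)
  qed
  have contF: "cont_on_subs M (snd (F n))" for n
    by (rule cont_on_subs_mono[OF _ MF[of n]]) (use badF[of n] in \<open>simp add: bad_array_def\<close>)
  have "\<exists>N\<in>subs M. cont_on_subs N f"
    by (rule cont_on_subs_limit[where F = "\<lambda>n. snd (F n)" and st = st, OF infM contF lim])
  then obtain N where NM: "N \<in> subs M" and contf: "cont_on_subs N f" by blast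
  have badN: "bad_array C le N f"
    unfolding bad_array_def using contf NM fC by (auto simp: subs_def)
  have "\<exists>X\<in>subs K. \<not> lt (g X) (f X)" if KN: "K \<subseteq> N" and g: "bad_array C le K g" for K g
  proof (rule ccontr)
    assume "\<not> ?thesis"
    hence gf: "lt (g X) (f X)" if "X \<in> subs K" for X using that by blast
    have KM: "K \<subseteq> M" using KN NM by (auto simp: subs_def)
    have infK: "infinite K" and contg: "cont_on_subs K g" using g by (auto simp: bad_array_def)
    hence KK: "K \<in> subs K" by (simp add: subs_def)
    obtain l where l: "\<And>j Y. l \<le> j \<Longrightarrow> Y \<in> subs K \<Longrightarrow> Y \<inter> {..<j} = K \<inter> {..<j} \<Longrightarrow> g Y = g K"
      using cont_on_subsD[OF contg KK] by metis
    define u where "u = K \<inter> {..<l}"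
    define n where "n = prod_encode (set_encode u, l)"
    have tn: "t n = u" unfolding t_def n_def by (simp add: u_def)
    have "l \<le> n" unfolding n_def by (rule le_prod_encode_2)
    hence ln: "l \<le> a n" using ale[of n] by simp
    \<comment> \<open>The competitor at stage \<open>n\<close>: below \<open>a n\<close> its domain is the old one, so that it is \<open>g\<close> on the
      subsets of \<open>K\<close> and the old array on the other sets.  The latter are told apart below \<open>a n\<close>.\<close>
    define M' where "M' = (M \<inter> {..<a n}) \<union> (K \<inter> {a n..})"
    define h where "h Y = (if Y \<subseteq> K then g Y else snd (F n) Y)" for Y
    have M'M: "M' \<subseteq> M" using KM by (auto simp: M'_def)
    note sM'M = subs_mono[OF M'M]
    have inK: "Y \<subseteq> K \<longleftrightarrow> Y \<inter> {..<a n} \<subseteq> K" if "Y \<in> subs M'" for Y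
    proof
      assume *: "Y \<inter> {..<a n} \<subseteq> K"
      show "Y \<subseteq> K"
      proof
        fix y assume "y \<in> Y"
        thus "y \<in> K" using * that by (cases "y < a n") (auto simp: subs_def M'_def)
      qed
    qed auto
    have sK: "Y \<in> subs K" if "Y \<in> subs M'" "Y \<subseteq> K" for Y using that by (simp add: subs_def)
    have gF: "lt (g Y) (snd (F n) Y)" if "Y \<in> subs K" for Y
      using gf[OF that] flt[OF subs_mono[OF KM that], of n]
        transpD[OF tr, of "g Y" "f Y" "snd (F n) Y"] by (elim disjE) simp_all
    have "bad_array C le M' h"
      unfolding bad_array_def
    proof (intro conjI ballI)
      have "K \<inter> {a n..} \<subseteq> M'" by (simp add: M'_def)
      thus "infinite M'" using infinite_Int_atLeast[OF infK] finite_subset by blast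
      show "cont_on_subs M' h"
        unfolding cont_on_subs_def
      proof
        fix Y assume Y: "Y \<in> subs M'"
        show "\<exists>k. \<forall>Z\<in>subs M'. Z \<inter> {..<k} = Y \<inter> {..<k} \<longrightarrow> h Z = h Y"
        proof (cases "Y \<subseteq> K")
          case True
          obtain k where k: "\<And>j Z. k \<le> j \<Longrightarrow> Z \<in> subs K \<Longrightarrow> Z \<inter> {..<j} = Y \<inter> {..<j} \<Longrightarrow> g Z = g Y"
            using cont_on_subsD[OF contg sK[OF Y True]] by metis
          have "h Z = h Y" if Z: "Z \<in> subs M'" "Z \<inter> {..<max k (a n)} = Y \<inter> {..<max k (a n)}" for Z
          proof -
            have "Z \<inter> {..<a n} = Y \<inter> {..<a n}" by (rule agree_le[OF _ Z(2)]) simp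
            hence "Z \<subseteq> K" using inK[OF Y] inK[OF Z(1)] True by simp
            thus ?thesis using k[OF _ sK[OF Z(1)] Z(2)] True by (simp add: h_def)
          qed
          thus ?thesis by blast
        next
          case False
          obtain k where k: "\<And>j Z. k \<le> j \<Longrightarrow> Z \<in> subs M \<Longrightarrow> Z \<inter> {..<j} = Y \<inter> {..<j} \<Longrightarrow> snd (F n) Z = snd (F n) Y"
            using cont_on_subsD[OF contF sM'M[OF Y]] by metis
          have "h Z = h Y" if Z: "Z \<in> subs M'" "Z \<inter> {..<max k (a n)} = Y \<inter> {..<max k (a n)}" for Z
          proof -
            have "Z \<inter> {..<a n} = Y \<inter> {..<a n}" by (rule agree_le[OF _ Z(2)]) simp
            hence "\<not> Z \<subseteq> K" using inK[OF Y] inK[OF Z(1)] False by simp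
            thus ?thesis using k[OF _ sM'M[OF Z(1)] Z(2)] False by (simp add: h_def)
          qed
          thus ?thesis by blast
        qed
      qed
      fix Y assume Y: "Y \<in> subs M'"
      note tY = tail_subs[OF Y]
      have FY: "snd (F n) Y \<in> C" "snd (F n) (tail Y) \<in> C" "\<not> le (snd (F n) Y) (snd (F n) (tail Y))"
        using badF[of n] sMF[OF sM'M[OF Y], of n] sMF[OF sM'M[OF tY], of n] by (auto simp: bad_array_def)
      have gY: "g Z \<in> C" "\<not> le (g Z) (g (tail Z))" if "Z \<in> subs K" for Z
        using g that by (auto simp: bad_array_def)
      show "h Y \<in> C" using FY gY(1)[OF sK[OF Y]] by (simp add: h_def)
      show "\<not> le (h Y) (h (tail Y))"
      proof (cases "Y \<subseteq> K")
        case True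
        hence "tail Y \<subseteq> K" by (auto simp: tail_def)
        thus ?thesis using True gY(2)[OF sK[OF Y True]] by (simp add: h_def)
      next
        case YK: False
        show ?thesis
        proof (cases "tail Y \<subseteq> K")
          case True
          \<comment> \<open>The only mixed case: the old value at \<open>Y\<close> meets a new value at \<open>tail Y\<close>, which lies below the
            old value there.\<close>
          have "\<not> le (snd (F n) Y) (g (tail Y))"
          proof
            assume "le (snd (F n) Y) (g (tail Y))"
            moreover have "le (g (tail Y)) (snd (F n) (tail Y))"
              by (rule lt_le[OF gF[OF sK[OF tY True]]])
            ultimately have "le (snd (F n) Y) (snd (F n) (tail Y))"
              using transp_onD[OF le_tr FY(1) gY(1)[OF sK[OF tY True]] FY(2)] by blast
            thus False using FY(3) by simp
          qed
          thus ?thesis using True YK by (simp add: h_def)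
        next
          case False
          thus ?thesis using YK FY(3) by (simp add: h_def)
        qed
      qed
    qed
    moreover have "refines lt (M', h) (F n)"
      unfolding refines_def fst_conv snd_conv
    proof (intro conjI ballI)
      show "M' \<subseteq> fst (F n)" using M'M MF by blast
      fix Y assume "Y \<in> subs M'"
      thus "lt (h Y) (snd (F n) Y) \<or> h Y = snd (F n) Y" using gF[OF sK] by (auto simp: h_def)
    qed
    moreover have "fst (M', h) \<inter> {..<a n} = fst (F n) \<inter> {..<a n}"
      unfolding fst_conv Mfix[symmetric] using KM by (auto simp: M'_def)
    moreover define X where "X = u \<union> (K \<inter> {a n..})"
    have X: "X \<in> subs K" "X \<in> subs M'" "X \<inter> {..<a n} = u"
      using infinite_Int_atLeast[OF infK] KM ln by (auto simp: X_def u_def subs_def M'_def)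
    have hK: "h Y = g K" if Y: "Y \<in> subs M'" "Y \<inter> {..<a n} = u" for Y
    proof -
      have "Y \<subseteq> K" using inK[OF Y(1)] Y(2) by (simp add: u_def)
      moreover have "Y \<inter> {..<l} = K \<inter> {..<l}"
      proof -
        have "Y \<inter> {..<l} = (Y \<inter> {..<a n}) \<inter> {..<l}" using ln by auto
        also have "\<dots> = K \<inter> {..<l}" unfolding Y(2) u_def by simp
        finally show ?thesis .
      qed
      ultimately show ?thesis using l[OF order_refl sK[OF Y(1)]] by (simp add: h_def)
    qed
    have "const_at (a n) (t n) (g K) (M', h)"
      unfolding const_at_def fst_conv snd_conv tn using hK X by blast
    ultimately obtain v where v: "const_at (a n) (t n) v (F (Suc n))" "\<not> lt (g K) v"
      using min1[of "(M', h)" n "g K"] by auto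
    have XM: "X \<in> subs M" by (rule subs_mono[OF KM X(1)])
    have "snd (F (Suc n)) X = v"
      using v(1) sMF[OF XM] X(3) unfolding const_at_def tn by blast
    moreover have "g X = g K" using hK[OF X(2,3)] X(1) by (simp add: h_def subs_def)
    ultimately have "lt (g K) v"
      using gf[OF X(1)] flt[OF XM, of "Suc n"] transpD[OF tr, of "g X" "f X" v] by metis
    thus False using v(2) by simp
  qed
  thus ?thesis using badN by blast
qed

section \<open>Embeddings of closed linear orderings\<close>

lemma smc_embeddingD:
  assumes "smc_embedding V W h"
  shows "\<And>a. a \<in> V \<Longrightarrow> h a \<in> W" "\<And>a b. a \<in> V \<Longrightarrow> b \<in> V \<Longrightarrow> a < b \<Longrightarrow> h a < h b"
    "\<And>p x. (\<And>n :: nat. p n \<in> V) \<Longrightarrow> x \<in> V \<Longrightarrow> p \<longlonglongrightarrow> x \<Longrightarrow> (\<lambda>n. h (p n)) \<longlonglongrightarrow> h x"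
  using assms unfolding smc_embedding_def strict_mono_on_def by blast+

lemma smc_embeddingI:
  assumes "\<And>a. a \<in> V \<Longrightarrow> h a \<in> W" "\<And>a b. a \<in> V \<Longrightarrow> b \<in> V \<Longrightarrow> a < b \<Longrightarrow> h a < h b"
    "\<And>p x. (\<And>n :: nat. p n \<in> V) \<Longrightarrow> x \<in> V \<Longrightarrow> p \<longlonglongrightarrow> x \<Longrightarrow> (\<lambda>n. h (p n)) \<longlonglongrightarrow> h x"
  shows "smc_embedding V W h"
  using assms unfolding smc_embedding_def strict_mono_on_def by blast

lemma smc_embedding_id: "V \<subseteq> W \<Longrightarrow> smc_embedding V W (\<lambda>x. x)"
  by (rule smc_embeddingI) auto

lemma smc_embedding_comp:
  assumes g: "smc_embedding U V g" and h: "smc_embedding V W h"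
  shows "smc_embedding U W (\<lambda>x. h (g x))"
  by (rule smc_embeddingI) (use smc_embeddingD[OF g] smc_embeddingD[OF h] in auto)

lemma smc_embedding_target: "smc_embedding V W h \<Longrightarrow> W \<subseteq> W' \<Longrightarrow> smc_embedding V W' h"
  unfolding smc_embedding_def by blast

lemma smc_embedding_cong:
  assumes h: "smc_embedding V W h" and eq: "\<And>a. a \<in> V \<Longrightarrow> g a = h a"
  shows "smc_embedding V W g"
proof (rule smc_embeddingI)
  fix p x assume "\<And>n :: nat. p n \<in> V" "x \<in> V" "p \<longlonglongrightarrow> x"
  thus "(\<lambda>n. g (p n)) \<longlonglongrightarrow> g x" using smc_embeddingD(3)[OF h] by (simp add: eq)
qed (use smc_embeddingD[OF h] in \<open>auto simp: eq\<close>)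

lemma smc_embedding_uminus:
  assumes h: "smc_embedding V W h"
  shows "smc_embedding (uminus ` V) (uminus ` W) (\<lambda>y. - h (- y))"
proof (rule smc_embeddingI)
  fix p x assume p: "\<And>n :: nat. p n \<in> uminus ` V" "x \<in> uminus ` V" "p \<longlonglongrightarrow> x"
  have "- p n \<in> V" for n using p(1)[of n] by auto
  moreover have "- x \<in> V" using p(2) by auto
  moreover have "(\<lambda>n. - p n) \<longlonglongrightarrow> - x" by (rule tendsto_minus[OF p(3)])
  ultimately have "(\<lambda>n. h (- p n)) \<longlonglongrightarrow> h (- x)" by (rule smc_embeddingD(3)[OF h])
  thus "(\<lambda>n. - h (- p n)) \<longlonglongrightarrow> - h (- x)" by (rule tendsto_minus)
qed (use smc_embeddingD[OF h] in auto)

text \<open>Continuity at \<open>q\<close> is local: it suffices that the sequence eventually lies in a set on which the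
  map agrees with an embedding.\<close>

lemma smc_embedding_limit_eventually:
  assumes h: "smc_embedding V W h" and q: "q \<in> V" "p \<longlonglongrightarrow> q"
    and ev: "eventually (\<lambda>n :: nat. p n \<in> V \<and> g (p n) = h (p n)) sequentially"
  shows "(\<lambda>n. g (p n)) \<longlonglongrightarrow> h q"
proof -
  obtain n0 where n0: "\<And>n. n0 \<le> n \<Longrightarrow> p n \<in> V \<and> g (p n) = h (p n)"
    using ev by (auto simp: eventually_sequentially)
  have "(\<lambda>n. h (p (n + n0))) \<longlonglongrightarrow> h q"
    by (rule smc_embeddingD(3)[OF h]) (use n0 q LIMSEQ_ignore_initial_segment in auto)
  moreover have "g (p (n + n0)) = h (p (n + n0))" for n using n0[of "n + n0"] by simp
  ultimately have "(\<lambda>n. g (p (n + n0))) \<longlonglongrightarrow> h q" by simp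
  thus ?thesis by (rule LIMSEQ_offset)
qed

text \<open>Embeddings of the parts of \<open>V\<close> to the left and to the right of a point \<open>x\<close> of \<open>V\<close> fit together.
  Continuity at \<open>x\<close> follows by squeezing \<open>h (p n)\<close> between \<open>h (min (p n) x)\<close> and \<open>h (max (p n) x)\<close>.\<close>

lemma smc_embedding_glue:
  assumes x: "x \<in> V" and l: "smc_embedding (V \<inter> {..x}) W h" and r: "smc_embedding (V \<inter> {x..}) W h"
  shows "smc_embedding V W h"
proof -
  have mono: "h a < h b" if ab: "a \<in> V" "b \<in> V" "a < b" for a b
  proof -
    consider "b \<le> x" | "x \<le> a" | "a < x" "x < b" by linarith
    thus ?thesis
    proof cases
      case 3
      have "h a < h x" using 3 ab x by (intro smc_embeddingD(2)[OF l]) auto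
      also have "h x < h b" using 3 ab x by (intro smc_embeddingD(2)[OF r]) auto
      finally show ?thesis .
    qed (use ab smc_embeddingD(2)[OF l] smc_embeddingD(2)[OF r] in auto)
  qed
  hence mono_le: "h a \<le> h b" if "a \<in> V" "b \<in> V" "a \<le> b" for a b
    using that by (cases "a = b") (auto simp: less_imp_le)
  show ?thesis
  proof (rule smc_embeddingI)
    fix a assume "a \<in> V"
    thus "h a \<in> W" using smc_embeddingD(1)[OF l] smc_embeddingD(1)[OF r] by (cases "a \<le> x") auto
  next
    fix p q assume p: "\<And>n :: nat. p n \<in> V" and q: "q \<in> V" and lim: "p \<longlonglongrightarrow> q"
    consider "q < x" | "x < q" | "q = x" by linarith
    thus "(\<lambda>n. h (p n)) \<longlonglongrightarrow> h q"
    proof cases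
      case 1
      have "eventually (\<lambda>n. p n < x) sequentially" by (rule order_tendstoD(2)[OF lim 1])
      hence "eventually (\<lambda>n. p n \<in> V \<inter> {..x} \<and> h (p n) = h (p n)) sequentially"
        by eventually_elim (use p in auto)
      thus ?thesis using 1 q lim by (intro smc_embedding_limit_eventually[OF l]) auto
    next
      case 2
      have "eventually (\<lambda>n. x < p n) sequentially" by (rule order_tendstoD(1)[OF lim 2])
      hence "eventually (\<lambda>n. p n \<in> V \<inter> {x..} \<and> h (p n) = h (p n)) sequentially"
        by eventually_elim (use p in auto)
      thus ?thesis using 2 q lim by (intro smc_embedding_limit_eventually[OF r]) auto
    next
      case 3
      have in_l: "min (p n) x \<in> V \<inter> {..x}" and in_r: "max (p n) x \<in> V \<inter> {x..}" for n
        using p[of n] x by (auto simp: min_def max_def)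
      have "(\<lambda>n. min (p n) x) \<longlonglongrightarrow> x" using tendsto_min[OF lim tendsto_const[of x]] 3 by simp
      hence lo: "(\<lambda>n. h (min (p n) x)) \<longlonglongrightarrow> h x"
        by (intro smc_embeddingD(3)[OF l] in_l) (use x in auto)
      have "(\<lambda>n. max (p n) x) \<longlonglongrightarrow> x" using tendsto_max[OF lim tendsto_const[of x]] 3 by simp
      hence hi: "(\<lambda>n. h (max (p n) x)) \<longlonglongrightarrow> h x"
        by (intro smc_embeddingD(3)[OF r] in_r) (use x in auto)
      have "h (min (p n) x) \<le> h (p n)" "h (p n) \<le> h (max (p n) x)" for n
        using in_l[of n] in_r[of n] p[of n] by (auto intro!: mono_le)
      thus ?thesis unfolding 3 by (intro tendsto_sandwich[OF _ _ lo hi]) auto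
    qed
  qed (rule mono)
qed

text \<open>The domains of the left half of a sum with limit point \<open>x\<close>: nonempty sets, each separated from the
  next by a gap, that converge to \<open>x\<close> from the left.  The right half is treated as the left half of
  the sum reflected at the origin.\<close>

definition half_sum :: "real \<Rightarrow> (nat \<Rightarrow> real set) \<Rightarrow> bool" where
  "half_sum x D \<longleftrightarrow> (\<forall>i. D i \<noteq> {}) \<and> (\<forall>i. \<exists>z. (\<forall>a\<in>D i. a < z) \<and> (\<forall>b\<in>D (Suc i). z < b)) \<and>
     (\<forall>a. (\<forall>n. a n \<in> D n) \<longrightarrow> a \<longlonglongrightarrow> x)"

lemma half_sumI:
  assumes "\<And>i. D i \<noteq> {}" "\<And>i. \<exists>z. (\<forall>a\<in>D i. a < z) \<and> (\<forall>b\<in>D (Suc i). z < b)"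
    "\<And>a. \<forall>n. a n \<in> D n \<Longrightarrow> a \<longlonglongrightarrow> x"
  shows "half_sum x D"
  unfolding half_sum_def using assms by simp

lemma half_sum_nonempty: "half_sum x D \<Longrightarrow> D i \<noteq> {}"
  unfolding half_sum_def by (elim conjE) (erule spec)

lemma half_sum_gap:
  assumes D: "half_sum x D"
  obtains z where "\<And>i j a. j \<le> i \<Longrightarrow> a \<in> D j \<Longrightarrow> a < z i" "\<And>i j b. i < j \<Longrightarrow> b \<in> D j \<Longrightarrow> z i < (b :: real)"
proof -
  have "\<forall>i. \<exists>z. (\<forall>a\<in>D i. a < z) \<and> (\<forall>b\<in>D (Suc i). z < b)" using D by (simp add: half_sum_def)
  then obtain z where z: "\<And>i a. a \<in> D i \<Longrightarrow> a < z i" "\<And>i b. b \<in> D (Suc i) \<Longrightarrow> z i < b" by metis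
  have "z i < z (Suc i)" for i
  proof -
    obtain b where "b \<in> D (Suc i)" using half_sum_nonempty[OF D] by blast
    thus ?thesis using z by force
  qed
  hence mono: "strict_mono z" by (simp add: strict_mono_Suc_iff)
  show ?thesis
  proof (rule that)
    fix i j a assume "j \<le> i" "a \<in> D j"
    thus "a < z i" using z(1)[of a j] strict_mono_less_eq[OF mono, of j i] by simp
  next
    fix i j b assume "i < j" "b \<in> D j"
    hence "z i \<le> z (j - 1)" "z (j - 1) < b"
      using strict_mono_less_eq[OF mono, of i "j - 1"] z(2)[of b "j - 1"] by auto
    thus "z i < b" by simp
  qed
qed

lemma half_sum_less:
  assumes D: "half_sum x D" and "i < j" "a \<in> D i" "b \<in> D j"
  shows "a < b"
proof -
  obtain z where "\<And>i j a. j \<le> i \<Longrightarrow> a \<in> D j \<Longrightarrow> a < z i" "\<And>i j b. i < j \<Longrightarrow> b \<in> D j \<Longrightarrow> z i < b"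
    using half_sum_gap[OF D] by metis
  hence "a < z i" "z i < b" using assms(2-) by auto
  thus ?thesis by simp
qed

lemma half_sum_eventually_above:
  assumes D: "half_sum x D" and a: "a < x"
  shows "\<exists>n. \<forall>m\<ge>n. \<forall>b\<in>D m. a < b"
proof -
  have "\<forall>n. \<exists>c. c \<in> D n" using D by (auto simp: half_sum_def)
  then obtain c where c: "\<And>n. c n \<in> D n" by metis
  hence "c \<longlonglongrightarrow> x" using D by (simp add: half_sum_def)
  from order_tendstoD(1)[OF this a] obtain n where n: "a < c n"
    by (auto simp: eventually_sequentially)
  have "a < b" if "Suc n \<le> m" "b \<in> D m" for m b
    using n half_sum_less[OF D, of n m "c n" b] c that by auto
  thus ?thesis by blast
qed

lemma half_sum_below:
  assumes D: "half_sum x D" and a: "a \<in> D i"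
  shows "a < x"
proof -
  have "\<forall>n. \<exists>c. c \<in> D n" using D by (auto simp: half_sum_def)
  then obtain c where c: "\<And>n. c n \<in> D n" by metis
  hence lim: "c \<longlonglongrightarrow> x" using D by (simp add: half_sum_def)
  have "a < c (Suc i)" using half_sum_less[OF D _ a c] by simp
  also have "c (Suc i) \<le> x"
    by (rule incseq_le[OF incseq_SucI lim]) (use half_sum_less[OF D _ c c] in \<open>auto simp: less_imp_le\<close>)
  finally show ?thesis .
qed

text \<open>The left half of a sum embeds into another one if each summand embeds into arbitrarily late
  summands; the relation \<open>E\<close> carries the condition on the labels.  The resulting map is continuous at
  the points of a summand since the gaps isolate the summand, and at \<open>x\<close> since it is monotone and the
  summands of the target converge.\<close>

lemma half_sum_embedding:
  assumes D: "half_sum x D" and D': "half_sum x' D'"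
    and emb: "\<And>i m. \<exists>j\<ge>m. \<exists>h. smc_embedding (D i) (D' j) h \<and> (\<forall>a\<in>D i. E a (h a))"
  shows "\<exists>h. smc_embedding ((\<Union>i. D i) \<union> {x}) ((\<Union>i. D' i) \<union> {x'}) h \<and> h x = x' \<and> (\<forall>a\<in>(\<Union>i. D i). E a (h a))"
proof -
  \<comment> \<open>Choose strictly increasing target indices \<open>J i\<close>.\<close>
  define P where "P i j \<longleftrightarrow> (\<exists>h. smc_embedding (D i) (D' j) h \<and> (\<forall>a\<in>D i. E a (h a)))" for i j
  have "\<exists>J. \<forall>i. P i (J i) \<and> J i < J (Suc i)"
  proof (rule dependent_nat_choice)
    show "\<exists>j. P 0 j" using emb[of 0 0] unfolding P_def by blast
    fix j i
    show "\<exists>k. P (Suc i) k \<and> j < k" using emb[of "Suc j" "Suc i"] unfolding P_def by (meson Suc_le_lessD)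
  qed
  then obtain J where J: "\<And>i. P i (J i)" "\<And>i. J i < J (Suc i)" by blast
  obtain H where H: "\<And>i. smc_embedding (D i) (D' (J i)) (H i)" "\<And>i a. a \<in> D i \<Longrightarrow> E a (H i a)"
    using J(1) unfolding P_def by metis
  have Jmono: "strict_mono J" using J(2) by (simp add: strict_mono_Suc_iff)
  note less = half_sum_less[OF D] and below = half_sum_below[OF D]
  define idx where "idx y = (SOME i. y \<in> D i)" for y
  have idx: "idx y = i" if "y \<in> D i" for y i
  proof -
    have "y \<in> D (idx y)" unfolding idx_def using that by (rule someI)
    thus ?thesis using less[of i "idx y" y y] less[of "idx y" i y y] that by (cases "idx y" i rule: linorder_cases) auto
  qed
  define h where "h y = (if y = x then x' else H (idx y) y)" for y
  have hx: "h x = x'" by (simp add: h_def)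
  have hD: "h y = H i y" if "y \<in> D i" for y i
    using below[OF that] idx[OF that] by (auto simp: h_def)
  have hD': "h y \<in> D' (J i)" if "y \<in> D i" for y i
    using smc_embeddingD(1)[OF H(1) that] hD[OF that] by simp
  have hbelow: "h y < x'" if "y \<in> D i" for y i using half_sum_below[OF D' hD'[OF that]] .
  define V where "V = (\<Union>i. D i) \<union> {x}"
  have Vcases: "y = x \<or> (\<exists>i. y \<in> D i)" if "y \<in> V" for y using that by (auto simp: V_def)
  have mono: "h a < h b" if ab: "a \<in> V" "b \<in> V" "a < b" for a b
  proof (cases "b = x")
    case True
    then obtain i where "a \<in> D i" using Vcases[OF ab(1)] ab(3) by auto
    thus ?thesis using hbelow True hx by simp
  next
    case False
    then obtain k where k: "b \<in> D k" using Vcases[OF ab(2)] by auto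
    hence "a \<noteq> x" using below[OF k] ab(3) by auto
    then obtain i where i: "a \<in> D i" using Vcases[OF ab(1)] by auto
    have "\<not> k < i" using less[OF _ k i] ab(3) by auto
    then consider "i = k" | "i < k" by linarith
    thus ?thesis
    proof cases
      case 1
      thus ?thesis using smc_embeddingD(2)[OF H(1)[of k]] hD[OF i] hD[OF k] i k ab(3) by simp
    next
      case 2
      hence "J i < J k" using strict_mono_less[OF Jmono] by simp
      from half_sum_less[OF D' this hD'[OF i] hD'[OF k]] show ?thesis .
    qed
  qed
  have "smc_embedding V ((\<Union>i. D' i) \<union> {x'}) h"
  proof (rule smc_embeddingI)
    fix a assume "a \<in> V"
    from Vcases[OF this] show "h a \<in> (\<Union>i. D' i) \<union> {x'}"
    proof
      assume "a = x"
      thus ?thesis using hx by simp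
    next
      assume "\<exists>i. a \<in> D i"
      then obtain i where "a \<in> D i" ..
      from hD'[OF this] show ?thesis by blast
    qed
  next
    fix p q assume p: "\<And>n :: nat. p n \<in> V" and q: "q \<in> V" and lim: "p \<longlonglongrightarrow> q"
    show "(\<lambda>n. h (p n)) \<longlonglongrightarrow> h q"
    proof (cases "q = x")
      case True
      show ?thesis
        unfolding True hx
      proof (rule order_tendstoI)
        fix a assume "a < x'"
        then obtain m where m: "\<And>n b. m \<le> n \<Longrightarrow> b \<in> D' n \<Longrightarrow> a < b"
          using half_sum_eventually_above[OF D'] by blast
        obtain v where v: "v \<in> D m" using half_sum_nonempty[OF D] by blast
        have "m \<le> J m" by (rule strict_mono_imp_increasing[OF Jmono])
        hence av: "a < h v" using m hD'[OF v] by blast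
        have "eventually (\<lambda>n. v < p n) sequentially"
          by (rule order_tendstoD(1)[OF lim]) (use below[OF v] True in simp)
        thus "eventually (\<lambda>n. a < h (p n)) sequentially"
        proof eventually_elim
          case (elim n)
          have "v \<in> V" using v by (auto simp: V_def)
          from mono[OF this p elim] show ?case using av by simp
        qed
      next
        fix a assume a: "x' < a"
        have "h (p n) \<le> x'" for n using Vcases[OF p[of n]] hx hbelow by (auto simp: less_imp_le)
        hence "h (p n) < a" for n using a le_less_trans by blast
        thus "eventually (\<lambda>n. h (p n) < a) sequentially" by simp
      qed
    next
      case False
      then obtain i where i: "q \<in> D i" using Vcases[OF q] by auto
      obtain z where z: "\<And>i j a. j \<le> i \<Longrightarrow> a \<in> D j \<Longrightarrow> a < z i" "\<And>i j b. i < j \<Longrightarrow> b \<in> D j \<Longrightarrow> z i < b"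
        using half_sum_gap[OF D] by metis
      obtain b where b: "b \<in> D (Suc i)" using half_sum_nonempty[OF D] by blast
      define lo where "lo = (if i = 0 then q - 1 else z (i - 1))"
      have "lo < q" using z(2)[of "i - 1" i q] i by (auto simp: lo_def)
      hence "eventually (\<lambda>n. lo < p n) sequentially" by (rule order_tendstoD(1)[OF lim])
      moreover have "eventually (\<lambda>n. p n < z i) sequentially"
        by (rule order_tendstoD(2)[OF lim]) (use z(1)[of i i q] i in simp)
      ultimately have "eventually (\<lambda>n. p n \<in> D i \<and> h (p n) = H i (p n)) sequentially"
      proof eventually_elim
        case (elim n)
        have "p n \<noteq> x" using elim(2) z(2)[of i "Suc i" b] b below[OF b] by auto
        then obtain k where k: "p n \<in> D k" using Vcases[OF p[of n]] by auto
        have "\<not> i < k" using z(2)[OF _ k, of i] elim(2) by auto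
        moreover have "\<not> k < i"
        proof
          assume "k < i"
          hence "p n < z (i - 1)" "lo = z (i - 1)" using z(1)[OF _ k, of "i - 1"] by (auto simp: lo_def)
          thus False using elim(1) by simp
        qed
        ultimately have "k = i" by simp
        thus ?case using k hD[OF k] by simp
      qed
      from smc_embedding_limit_eventually[OF H(1) i lim this] show ?thesis using hD[OF i] by simp
    qed
  qed (rule mono)
  moreover have "E a (h a)" if "a \<in> (\<Union>i. D i)" for a using that H(2) hD by auto
  ultimately show ?thesis using hx unfolding V_def by blast
qed

section \<open>Embeddability of labelled orderings and of their sums\<close>

lemma qcclo_le_refl:
  assumes "reflp_on Q le" "A \<in> qcclos Q"
  shows "qcclo_le le A A"
proof -
  have "le (the (A a)) (the (A a))" if "a \<in> dom A" for a
  proof (rule reflp_onD[OF assms(1)])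
    show "the (A a) \<in> Q" using that assms(2) by (auto simp: qcclos_def ran_def)
  qed
  thus ?thesis unfolding qcclo_le_def using smc_embedding_id[of "dom A" "dom A"] by blast
qed

lemma qcclo_label_in: "A \<in> qcclos Q \<Longrightarrow> a \<in> dom A \<Longrightarrow> the (A a) \<in> Q"
  by (auto simp: qcclos_def ran_def)

lemma qcclo_le_trans:
  assumes tr: "transp_on Q le" and A: "A \<in> qcclos Q" and B: "B \<in> qcclos Q" and C: "C \<in> qcclos Q"
    and AB: "qcclo_le le A B" and BC: "qcclo_le le B C"
  shows "qcclo_le le A C"
proof -
  obtain g where g: "smc_embedding (dom A) (dom B) g" "\<And>a. a \<in> dom A \<Longrightarrow> le (the (A a)) (the (B (g a)))"
    using AB by (auto simp: qcclo_le_def)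
  obtain h where h: "smc_embedding (dom B) (dom C) h" "\<And>a. a \<in> dom B \<Longrightarrow> le (the (B a)) (the (C (h a)))"
    using BC by (auto simp: qcclo_le_def)
  have "le (the (A a)) (the (C (h (g a))))" if a: "a \<in> dom A" for a
  proof -
    have ga: "g a \<in> dom B" using smc_embeddingD(1)[OF g(1) a] .
    have hga: "h (g a) \<in> dom C" using smc_embeddingD(1)[OF h(1) ga] .
    show ?thesis
      using transp_onD[OF tr qcclo_label_in[OF A a] qcclo_label_in[OF B ga] qcclo_label_in[OF C hga] g(2)[OF a] h(2)[OF ga]] .
  qed
  thus ?thesis unfolding qcclo_le_def using smc_embedding_comp[OF g(1) h(1)] by blast
qed

lemma qcclo_le_map_le:
  assumes "reflp_on Q le" "A \<in> qcclos Q" "A \<subseteq>\<^sub>m B"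
  shows "qcclo_le le A B"
proof -
  have "the (B a) = the (A a)" if "a \<in> dom A" for a using assms(3) that by (simp add: map_le_def)
  moreover have "le (the (A a)) (the (A a))" if "a \<in> dom A" for a
    using reflp_onD[OF assms(1) qcclo_label_in[OF assms(2) that]] .
  moreover have "dom A \<subseteq> dom B" by (rule map_le_implies_dom_le[OF assms(3)])
  ultimately show ?thesis unfolding qcclo_le_def using smc_embedding_id[of "dom A" "dom B"]
    by (intro exI[of _ "\<lambda>x. x"]) simp
qed

text \<open>Every term embeds into some later term.\<close>

definition unbounded_seq :: "('q \<Rightarrow> 'q \<Rightarrow> bool) \<Rightarrow> (nat \<Rightarrow> real \<rightharpoonup> 'q) \<Rightarrow> bool" where
  "unbounded_seq le L \<longleftrightarrow> (\<forall>n. \<exists>k>n. qcclo_le le (L n) (L k))"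

text \<open>\<open>A\<close> is an unbounded sum with central label \<open>p\<close>, left summands \<open>L i\<close> and right summands \<open>R i\<close>.
  Unlike in a sum proper, all summands may be empty, so that singletons are included.\<close>

definition decomposed ::
    "'q set \<Rightarrow> ('q \<Rightarrow> 'q \<Rightarrow> bool) \<Rightarrow> (real \<rightharpoonup> 'q) \<Rightarrow> (nat \<Rightarrow> real \<rightharpoonup> 'q) \<Rightarrow> 'q \<Rightarrow> (nat \<Rightarrow> real \<rightharpoonup> 'q) \<Rightarrow> bool" where
  "decomposed Q le A L p R \<longleftrightarrow> p \<in> Q \<and> (\<forall>i. L i \<in> qcclos Q) \<and> (\<forall>i. R i \<in> qcclos Q) \<and>
     unbounded_seq le L \<and> unbounded_seq le R \<and>
     (\<forall>i. L i \<subseteq>\<^sub>m A) \<and> (\<forall>i. R i \<subseteq>\<^sub>m A) \<and>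
     (\<exists>x. A x = Some p \<and> dom A = (\<Union>i. dom (L i)) \<union> {x} \<union> (\<Union>i. dom (R i)) \<and>
       ((\<forall>i. dom (L i) = {}) \<or> half_sum x (\<lambda>i. dom (L i))) \<and>
       ((\<forall>i. dom (R i) = {}) \<or> half_sum (- x) (\<lambda>i. uminus ` dom (R i))))"

lemma unbounded_seq_ge:
  assumes tr: "transp_on Q le" and re: "reflp_on Q le" and L: "\<And>i. L i \<in> qcclos Q" and u: "unbounded_seq le L"
  shows "\<exists>k\<ge>m. qcclo_le le (L n) (L k)"
proof (induction m)
  case 0
  show ?case using qcclo_le_refl[OF re L] by blast
next
  case (Suc m)
  then obtain k where k: "m \<le> k" "qcclo_le le (L n) (L k)" by blast
  obtain l where l: "k < l" "qcclo_le le (L k) (L l)" using u unfolding unbounded_seq_def by blast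
  have "qcclo_le le (L n) (L l)" by (rule qcclo_le_trans[OF tr L L L k(2) l(2)])
  thus ?case using k l by (intro exI[of _ l]) auto
qed

lemma summands_dominated:
  assumes tr: "transp_on Q le" and re: "reflp_on Q le"
    and L: "L i \<in> qcclos Q" and L': "\<And>i. L' i \<in> qcclos Q" and u: "unbounded_seq le L'"
    and le: "\<exists>j. qcclo_le le (L i) (L' j)" and A: "L i \<subseteq>\<^sub>m A" and B: "\<And>j. L' j \<subseteq>\<^sub>m B"
  shows "\<exists>j\<ge>m. \<exists>h. smc_embedding (dom (L i)) (dom (L' j)) h \<and>
    (\<forall>a\<in>dom (L i). le (the (A a)) (the (B (h a))))"
proof -
  obtain j0 where j0: "qcclo_le le (L i) (L' j0)" using le by blast
  obtain j where j: "m \<le> j" "qcclo_le le (L' j0) (L' j)" using unbounded_seq_ge[OF tr re L' u] by blast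
  have "qcclo_le le (L i) (L' j)" by (rule qcclo_le_trans[OF tr L L' L' j0 j(2)])
  then obtain h where h: "smc_embedding (dom (L i)) (dom (L' j)) h"
    "\<And>a. a \<in> dom (L i) \<Longrightarrow> le (the (L i a)) (the (L' j (h a)))" by (auto simp: qcclo_le_def)
  have "le (the (A a)) (the (B (h a)))" if a: "a \<in> dom (L i)" for a
  proof -
    have "A a = L i a" using A a by (simp add: map_le_def)
    moreover have "B (h a) = L' j (h a)"
      using B[of j] smc_embeddingD(1)[OF h(1) a] by (simp add: map_le_def)
    ultimately show ?thesis using h(2)[OF a] by simp
  qed
  thus ?thesis using h(1) j(1) by blast
qed

lemma smc_embedding_singleton: "y \<in> W \<Longrightarrow> smc_embedding {x} W (\<lambda>_. y)"
  by (rule smc_embeddingI) auto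

text \<open>Empty summands of \<open>A\<close> impose no condition: they occur only if all summands on that side are empty,
  and then that side of \<open>A\<close> consists of its central point.\<close>

theorem qcclo_le_decomposed:
  assumes tr: "transp_on Q le" and re: "reflp_on Q le"
    and A: "decomposed Q le A L p R" and B: "decomposed Q le B L' p' R'"
    and pp: "le p p'"
    and LL: "\<And>i. dom (L i) \<noteq> {} \<Longrightarrow> \<exists>j. qcclo_le le (L i) (L' j)"
    and RR: "\<And>i. dom (R i) \<noteq> {} \<Longrightarrow> \<exists>j. qcclo_le le (R i) (R' j)"
  shows "qcclo_le le A B"
proof -
  have A1: "\<And>i. L i \<in> qcclos Q" "\<And>i. R i \<in> qcclos Q" "\<And>i. L i \<subseteq>\<^sub>m A" "\<And>i. R i \<subseteq>\<^sub>m A"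
    using A by (auto simp: decomposed_def)
  have B1: "\<And>i. L' i \<in> qcclos Q" "\<And>i. R' i \<in> qcclos Q" "\<And>i. L' i \<subseteq>\<^sub>m B" "\<And>i. R' i \<subseteq>\<^sub>m B"
    "unbounded_seq le L'" "unbounded_seq le R'"
    using B by (auto simp: decomposed_def)
  obtain x where x: "A x = Some p" "dom A = (\<Union>i. dom (L i)) \<union> {x} \<union> (\<Union>i. dom (R i))"
    and xl: "(\<forall>i. dom (L i) = {}) \<or> half_sum x (\<lambda>i. dom (L i))"
    and xr: "(\<forall>i. dom (R i) = {}) \<or> half_sum (- x) (\<lambda>i. uminus ` dom (R i))"
    using A unfolding decomposed_def by blast
  obtain x' where x': "B x' = Some p'" "dom B = (\<Union>i. dom (L' i)) \<union> {x'} \<union> (\<Union>i. dom (R' i))"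
    and xl': "(\<forall>i. dom (L' i) = {}) \<or> half_sum x' (\<lambda>i. dom (L' i))"
    and xr': "(\<forall>i. dom (R' i) = {}) \<or> half_sum (- x') (\<lambda>i. uminus ` dom (R' i))"
    using B unfolding decomposed_def by blast
  define E where "E a b \<longleftrightarrow> le (the (A a)) (the (B b))" for a b
  have "\<exists>h. smc_embedding ((\<Union>i. dom (L i)) \<union> {x}) (dom B) h \<and> h x = x' \<and> (\<forall>a\<in>(\<Union>i. dom (L i)). E a (h a))"
  proof (cases "\<forall>i. dom (L i) = {}")
    case True
    thus ?thesis using smc_embedding_singleton[of x' "dom B" x] x' by (intro exI[of _ "\<lambda>_. x'"]) auto
  next
    case False
    hence hs: "half_sum x (\<lambda>i. dom (L i))" using xl by blast
    have ne: "dom (L i) \<noteq> {}" for i using half_sum_nonempty[OF hs] .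
    have dm: "\<exists>j\<ge>m. \<exists>h. smc_embedding (dom (L i)) (dom (L' j)) h \<and> (\<forall>a\<in>dom (L i). E a (h a))" for i m
      unfolding E_def
      by (rule summands_dominated[where L = L and L' = L', OF tr re A1(1) B1(1) B1(5) LL[OF ne] A1(3) B1(3)])
    have hs': "half_sum x' (\<lambda>i. dom (L' i))"
    proof -
      obtain j h where "smc_embedding (dom (L 0)) (dom (L' j)) h" using dm by blast
      hence "h ` dom (L 0) \<subseteq> dom (L' j)" by (simp add: smc_embedding_def)
      hence "dom (L' j) \<noteq> {}" using ne[of 0] by auto
      hence "\<not> (\<forall>i. dom (L' i) = {})" by metis
      thus ?thesis using xl' by (elim disjE) auto
    qed
    from half_sum_embedding[OF hs hs' dm] obtain h where
      h: "smc_embedding ((\<Union>i. dom (L i)) \<union> {x}) ((\<Union>i. dom (L' i)) \<union> {x'}) h" "h x = x'"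
        "\<forall>a\<in>(\<Union>i. dom (L i)). E a (h a)" by blast
    have "(\<Union>i. dom (L' i)) \<union> {x'} \<subseteq> dom B" using x' by auto
    thus ?thesis using smc_embedding_target[OF h(1)] h(2,3) by blast
  qed
  then obtain hl where hl: "smc_embedding ((\<Union>i. dom (L i)) \<union> {x}) (dom B) hl" "hl x = x'"
    "\<And>a i. a \<in> dom (L i) \<Longrightarrow> E a (hl a)" by blast
  have "\<exists>h. smc_embedding ((\<Union>i. dom (R i)) \<union> {x}) (dom B) h \<and> h x = x' \<and> (\<forall>a\<in>(\<Union>i. dom (R i)). E a (h a))"
  proof (cases "\<forall>i. dom (R i) = {}")
    case True
    thus ?thesis using smc_embedding_singleton[of x' "dom B" x] x' by (intro exI[of _ "\<lambda>_. x'"]) auto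
  next
    case False
    hence hs: "half_sum (- x) (\<lambda>i. uminus ` dom (R i))" using xr by blast
    have ne: "dom (R i) \<noteq> {}" for i using half_sum_nonempty[OF hs, of i] by simp
    have dm: "\<exists>j\<ge>m. \<exists>h. smc_embedding (dom (R i)) (dom (R' j)) h \<and> (\<forall>a\<in>dom (R i). E a (h a))" for i m
      unfolding E_def
      by (rule summands_dominated[where L = R and L' = R', OF tr re A1(2) B1(2) B1(6) RR[OF ne] A1(4) B1(4)])
    have dm': "\<exists>j\<ge>m. \<exists>h. smc_embedding (uminus ` dom (R i)) (uminus ` dom (R' j)) h \<and>
        (\<forall>a\<in>uminus ` dom (R i). E (- a) (- h a))" for i m
    proof -
      obtain j h where "m \<le> j" "smc_embedding (dom (R i)) (dom (R' j)) h" "\<forall>a\<in>dom (R i). E a (h a)"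
        using dm by blast
      thus ?thesis
        by (intro exI[of _ j] conjI exI[of _ "\<lambda>y. - h (- y)"] smc_embedding_uminus) auto
    qed
    have hs': "half_sum (- x') (\<lambda>i. uminus ` dom (R' i))"
    proof -
      obtain j h where "smc_embedding (dom (R 0)) (dom (R' j)) h" using dm by blast
      hence "h ` dom (R 0) \<subseteq> dom (R' j)" by (simp add: smc_embedding_def)
      hence "dom (R' j) \<noteq> {}" using ne[of 0] by auto
      hence "\<not> (\<forall>i. dom (R' i) = {})" by metis
      thus ?thesis using xr' by (elim disjE) auto
    qed
    from half_sum_embedding[OF hs hs' dm'] obtain h where
      h: "smc_embedding ((\<Union>i. uminus ` dom (R i)) \<union> {- x}) ((\<Union>i. uminus ` dom (R' i)) \<union> {- x'}) h" "h (- x) = - x'"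
        "\<forall>a\<in>(\<Union>i. uminus ` dom (R i)). E (- a) (- h a)" by blast
    have im: "uminus ` ((\<Union>i. uminus ` dom (S i)) \<union> {- y}) = (\<Union>i. dom (S i)) \<union> {y}" for S :: "nat \<Rightarrow> real \<rightharpoonup> 'a" and y
      by (simp add: image_Un image_UN image_image)
    have "smc_embedding ((\<Union>i. dom (R i)) \<union> {x}) ((\<Union>i. dom (R' i)) \<union> {x'}) (\<lambda>y. - h (- y))"
      using smc_embedding_uminus[OF h(1)] unfolding im .
    moreover have "(\<Union>i. dom (R' i)) \<union> {x'} \<subseteq> dom B" using x' by auto
    ultimately have "smc_embedding ((\<Union>i. dom (R i)) \<union> {x}) (dom B) (\<lambda>y. - h (- y))"
      by (rule smc_embedding_target)
    moreover have "E a (- h (- a))" if "a \<in> (\<Union>i. dom (R i))" for a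
    proof -
      have "- a \<in> (\<Union>i. uminus ` dom (R i))" using that by auto
      from bspec[OF h(3) this] show ?thesis by simp
    qed
    ultimately show ?thesis using h(2) by (intro exI[of _ "\<lambda>y. - h (- y)"]) auto
  qed
  then obtain hr where hr: "smc_embedding ((\<Union>i. dom (R i)) \<union> {x}) (dom B) hr" "hr x = x'"
    "\<And>a i. a \<in> dom (R i) \<Longrightarrow> E a (hr a)" by blast
  have Lx: "a < x" if "a \<in> dom (L i)" for a i
  proof -
    have "half_sum x (\<lambda>i. dom (L i))" using xl that by auto
    from half_sum_below[OF this that] show ?thesis .
  qed
  have Rx: "x < a" if "a \<in> dom (R i)" for a i
  proof -
    have "half_sum (- x) (\<lambda>i. uminus ` dom (R i))" using xr that by auto
    from half_sum_below[OF this, of "- a" i] that show ?thesis by auto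
  qed
  define h where "h y = (if y \<le> x then hl y else hr y)" for y
  have l: "dom A \<inter> {..x} = (\<Union>i. dom (L i)) \<union> {x}" and r: "dom A \<inter> {x..} = (\<Union>i. dom (R i)) \<union> {x}"
    unfolding x(2) using Lx Rx by force+
  have "smc_embedding (dom A) (dom B) h"
  proof (rule smc_embedding_glue)
    show "x \<in> dom A" using x by auto
    show "smc_embedding (dom A \<inter> {..x}) (dom B) h"
      unfolding l
    proof (rule smc_embedding_cong[OF hl(1)])
      fix a assume "a \<in> (\<Union>i. dom (L i)) \<union> {x}"
      hence "a = x \<or> (\<exists>i. a \<in> dom (L i))" by auto
      hence "a \<le> x" using Lx[of a] by fastforce
      thus "h a = hl a" by (simp add: h_def)
    qed
    show "smc_embedding (dom A \<inter> {x..}) (dom B) h"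
      unfolding r
    proof (rule smc_embedding_cong[OF hr(1)])
      fix a assume "a \<in> (\<Union>i. dom (R i)) \<union> {x}"
      hence "a = x \<or> (\<exists>i. a \<in> dom (R i))" by auto
      hence "x < a \<or> a = x" using Rx[of a] by blast
      thus "h a = hr a" using hl(2) hr(2) by (auto simp: h_def)
    qed
  qed
  moreover have "le (the (A a)) (the (B (h a)))" if a: "a \<in> dom A" for a
  proof -
    consider i where "a \<in> dom (L i)" | "a = x" | i where "a \<in> dom (R i)" using a x(2) by blast
    thus ?thesis
    proof cases
      case (1 i)
      thus ?thesis using hl(3)[OF 1] Lx[OF 1] by (simp add: h_def E_def)
    next
      case 2
      thus ?thesis using x(1) x'(1) hl(2) pp by (simp add: h_def)
    next
      case (3 i)
      thus ?thesis using hr(3)[OF 3] Rx[OF 3] by (simp add: h_def E_def)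
    qed
  qed
  ultimately show ?thesis unfolding qcclo_le_def by blast
qed

lemma set_less_gap:
  assumes "set_less A B" "A \<noteq> {}" "B \<noteq> {}"
  shows "\<exists>z. (\<forall>a\<in>A. a < z) \<and> (\<forall>b\<in>B. z < b)"
proof -
  have "Sup (ereal ` A) < Inf (ereal ` B)" using assms by (auto simp: set_less_def)
  then obtain z where z: "Sup (ereal ` A) < ereal z" "ereal z < Inf (ereal ` B)" using ereal_dense2 by blast
  have "a < z" if "a \<in> A" for a
  proof -
    have "ereal a \<le> Sup (ereal ` A)" using that by (intro Sup_upper) auto
    hence "ereal a < ereal z" using z(1) by (rule le_less_trans)
    thus ?thesis by simp
  qed
  moreover have "z < b" if "b \<in> B" for b
  proof -
    have "Inf (ereal ` B) \<le> ereal b" using that by (intro Inf_lower) auto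
    hence "ereal z < ereal b" using z(2) by (rule less_le_trans[rotated])
    thus ?thesis by simp
  qed
  ultimately show ?thesis by blast
qed

lemma decomposed_sum:
  assumes "is_sum Q L p R A" "unbounded_seq le L" "unbounded_seq le R"
  shows "decomposed Q le A L p R"
proof -
  obtain x where s: "sum_allowed Q L p R x" and A: "dom A = (\<Union>i. dom (L i)) \<union> {x} \<union> (\<Union>i. dom (R i))"
     "\<forall>i. L i \<subseteq>\<^sub>m A" "\<forall>i. R i \<subseteq>\<^sub>m A" "A x = Some p" using assms(1) by (auto simp: is_sum_def)
  have l: "half_sum x (\<lambda>i. dom (L i))" if "\<not> (\<forall>i. dom (L i) = {})"
  proof -
    have ne: "dom (L i) \<noteq> {}" for i using s that by (auto simp: sum_allowed_def)
    have "\<exists>z. (\<forall>a\<in>dom (L i). a < z) \<and> (\<forall>b\<in>dom (L (Suc i)). z < b)" for i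
      by (rule set_less_gap[OF _ ne ne]) (use s in \<open>simp add: sum_allowed_def\<close>)
    moreover have "a \<longlonglongrightarrow> x" if "\<forall>n. a n \<in> dom (L n)" for a using s that by (simp add: sum_allowed_def)
    ultimately show ?thesis by (intro half_sumI ne)
  qed
  have r: "half_sum (- x) (\<lambda>i. uminus ` dom (R i))" if "\<not> (\<forall>i. dom (R i) = {})"
  proof -
    have ne: "dom (R i) \<noteq> {}" for i using s that by (auto simp: sum_allowed_def)
    have "\<exists>z. (\<forall>a\<in>uminus ` dom (R i). a < z) \<and> (\<forall>b\<in>uminus ` dom (R (Suc i)). z < b)" for i
    proof -
      obtain z where "\<forall>a\<in>dom (R (Suc i)). a < z" "\<forall>b\<in>dom (R i). z < b"
        using set_less_gap[OF _ ne ne, of "Suc i" i] s by (auto simp: sum_allowed_def)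
      thus ?thesis by (intro exI[of _ "- z"]) auto
    qed
    moreover have "a \<longlonglongrightarrow> - x" if "\<forall>n. a n \<in> uminus ` dom (R n)" for a
    proof -
      have "- a n \<in> dom (R n)" for n using spec[OF that, of n] by auto
      hence "(\<lambda>n. - a n) \<longlonglongrightarrow> x" using s by (simp add: sum_allowed_def)
      from tendsto_minus[OF this] show ?thesis by simp
    qed
    moreover have "uminus ` dom (R i) \<noteq> {}" for i using ne[of i] by simp
    ultimately show ?thesis by (intro half_sumI)
  qed
  have "p \<in> Q" "\<forall>i. L i \<in> qcclos Q" "\<forall>i. R i \<in> qcclos Q" using s by (simp_all add: sum_allowed_def)
  thus ?thesis unfolding decomposed_def using A assms(2,3) l r by blast
qed

lemma decomposed_singleton:
  assumes re: "reflp_on Q le" and A: "A \<in> qcclos Q" "dom A = {x}"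
  shows "decomposed Q le A (\<lambda>_. Map.empty) (the (A x)) (\<lambda>_. Map.empty)"
proof -
  have "Map.empty \<in> qcclos Q" by (simp add: qcclos_def cclo_def)
  moreover have "unbounded_seq le (\<lambda>_. Map.empty)"
    unfolding unbounded_seq_def using qcclo_le_refl[OF re calculation] by blast
  moreover have "A x = Some (the (A x))"
  proof -
    have "x \<in> dom A" using A(2) by simp
    thus ?thesis by auto
  qed
  moreover have "the (A x) \<in> Q" using qcclo_label_in[OF A(1)] A(2) by simp
  ultimately show ?thesis unfolding decomposed_def using A(2) by (intro conjI exI[of _ x]) auto
qed

section \<open>The rank in the hierarchy\<close>

lemma C'_stage_qcclos: "C'_stage Q le \<alpha> \<subseteq> qcclos Q"
proof -
  have "wf (omega1 - Id)" using Well_order_omega1 by (simp add: well_order_on_def)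
  thus ?thesis
  proof (induction \<alpha> rule: wf_induct_rule)
    case (less \<alpha>)
    show ?case
    proof (cases "\<exists>\<beta>\<in>Field omega1. \<alpha> = succ1 \<beta>")
      case True
      then obtain \<beta> where \<beta>: "\<beta> \<in> Field omega1" "\<alpha> = succ1 \<beta>" by blast
      have "(\<beta>, \<alpha>) \<in> omega1 - Id" using underS_succ1[OF \<beta>(1)] \<beta>(2) by (auto simp: underS_def)
      thus ?thesis using less.IH[of \<beta>] unfolding \<beta>(2) C'_stage_succ[OF \<beta>(1)]
        by (auto simp: unbounded_sums_def)
    next
      case False
      show ?thesis
      proof (cases "underS omega1 \<alpha> = {}")
        case True
        thus ?thesis by (auto simp: C'_stage_zero)
      next
        case ne: False
        have "C'_stage Q le \<alpha> = (\<Union>\<beta>\<in>underS omega1 \<alpha>. C'_stage Q le \<beta>)"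
          using False by (intro C'_stage_limit ne) blast
        moreover have "C'_stage Q le \<beta> \<subseteq> qcclos Q" if "\<beta> \<in> underS omega1 \<alpha>" for \<beta>
          using less.IH[of \<beta>] that by (auto simp: underS_def)
        ultimately show ?thesis by blast
      qed
    qed
  qed
qed

lemma C'_qcclos: "C' Q le \<subseteq> qcclos Q"
  using C'_stage_qcclos unfolding C'_def by blast

text \<open>The index of the first stage that contains \<open>A\<close>; meaningful for \<open>A \<in> C' Q le\<close> only.\<close>

definition C'_rank :: "'q set \<Rightarrow> ('q \<Rightarrow> 'q \<Rightarrow> bool) \<Rightarrow> (real \<rightharpoonup> 'q) \<Rightarrow> nat set" where
  "C'_rank Q le A = (SOME \<alpha>. \<alpha> \<in> Field omega1 \<and> A \<in> C'_stage Q le \<alpha> \<and>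
     (\<forall>\<beta>. (\<beta>, \<alpha>) \<in> omega1 - Id \<longrightarrow> A \<notin> C'_stage Q le \<beta>))"

lemma C'_rank:
  assumes "A \<in> C' Q le"
  shows "C'_rank Q le A \<in> Field omega1" "A \<in> C'_stage Q le (C'_rank Q le A)"
    "\<And>\<beta>. (\<beta>, C'_rank Q le A) \<in> omega1 - Id \<Longrightarrow> A \<notin> C'_stage Q le \<beta>"
proof -
  have wf: "wf (omega1 - Id)" using Well_order_omega1 by (simp add: well_order_on_def)
  obtain \<alpha> where "\<alpha> \<in> {\<alpha> \<in> Field omega1. A \<in> C'_stage Q le \<alpha>}" using assms by (auto simp: C'_def)
  then obtain \<gamma> where \<gamma>: "\<gamma> \<in> {\<alpha> \<in> Field omega1. A \<in> C'_stage Q le \<alpha>}"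
    "\<And>\<beta>. (\<beta>, \<gamma>) \<in> omega1 - Id \<Longrightarrow> \<beta> \<notin> {\<alpha> \<in> Field omega1. A \<in> C'_stage Q le \<alpha>}"
    using wfE_min[OF wf, of \<alpha> "{\<alpha> \<in> Field omega1. A \<in> C'_stage Q le \<alpha>}"] by blast
  have "\<beta> \<in> Field omega1" if "(\<beta>, \<gamma>) \<in> omega1 - Id" for \<beta> using that by (auto simp: Field_def)
  hence "\<gamma> \<in> Field omega1 \<and> A \<in> C'_stage Q le \<gamma> \<and> (\<forall>\<beta>. (\<beta>, \<gamma>) \<in> omega1 - Id \<longrightarrow> A \<notin> C'_stage Q le \<beta>)"
    using \<gamma> by blast
  from someI[of "\<lambda>\<alpha>. \<alpha> \<in> Field omega1 \<and> A \<in> C'_stage Q le \<alpha> \<and>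
     (\<forall>\<beta>. (\<beta>, \<alpha>) \<in> omega1 - Id \<longrightarrow> A \<notin> C'_stage Q le \<beta>)", OF this, folded C'_rank_def]
  show "C'_rank Q le A \<in> Field omega1" "A \<in> C'_stage Q le (C'_rank Q le A)"
    "\<And>\<beta>. (\<beta>, C'_rank Q le A) \<in> omega1 - Id \<Longrightarrow> A \<notin> C'_stage Q le \<beta>" by blast+
qed

lemma C'_rank_le:
  assumes \<beta>: "\<beta> \<in> Field omega1" "A \<in> C'_stage Q le \<beta>"
  shows "(C'_rank Q le A, \<beta>) \<in> omega1"
proof -
  have A: "A \<in> C' Q le" using \<beta> by (auto simp: C'_def)
  have "(C'_rank Q le A, \<beta>) \<in> omega1 \<or> (\<beta>, C'_rank Q le A) \<in> omega1"
    using wo_rel.TOTALS[OF wo_rel_omega1] C'_rank(1)[OF A] \<beta>(1) by blast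
  thus ?thesis
  proof
    assume r: "(\<beta>, C'_rank Q le A) \<in> omega1"
    hence "\<beta> = C'_rank Q le A" using C'_rank(3)[OF A, of \<beta>] \<beta>(2) by blast
    thus ?thesis using r by simp
  qed
qed

text \<open>The well-founded relation with respect to which a bad array is taken minimal: smaller rank together
  with embeddability.  It relates the nonempty summands in a decomposition given by the hierarchy to
  their sum.\<close>

definition C'_less :: "'q set \<Rightarrow> ('q \<Rightarrow> 'q \<Rightarrow> bool) \<Rightarrow> (real \<rightharpoonup> 'q) \<Rightarrow> (real \<rightharpoonup> 'q) \<Rightarrow> bool" where
  "C'_less Q le B A \<longleftrightarrow> B \<in> C' Q le \<and> A \<in> C' Q le \<and>
     (C'_rank Q le B, C'_rank Q le A) \<in> omega1 - Id \<and> qcclo_le le B A"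

lemma wfp_C'_less: "wfp (C'_less Q le)"
proof -
  have "wf (inv_image (omega1 - Id) (C'_rank Q le))"
    using Well_order_omega1 by (intro wf_inv_image) (simp add: well_order_on_def)
  moreover have "{(B, A). C'_less Q le B A} \<subseteq> inv_image (omega1 - Id) (C'_rank Q le)"
    by (auto simp: C'_less_def inv_image_def)
  ultimately show ?thesis unfolding wfp_def by (rule wf_subset)
qed

lemma transp_on_C':
  assumes "transp_on Q le"
  shows "transp_on (C' Q le) (qcclo_le le)"
proof (rule transp_onI)
  fix A B C assume "A \<in> C' Q le" "B \<in> C' Q le" "C \<in> C' Q le" "qcclo_le le A B" "qcclo_le le B C"
  thus "qcclo_le le A C" using qcclo_le_trans[OF assms, of A B C] C'_qcclos[of Q le] by blast
qed

lemma transp_C'_less: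
  assumes "transp_on Q le"
  shows "transp (C'_less Q le)"
proof (rule transpI)
  fix A B C assume AB: "C'_less Q le A B" and BC: "C'_less Q le B C"
  have "trans (omega1 - Id)"
    using wo_rel.TRANS[OF wo_rel_omega1] wo_rel.ANTISYM[OF wo_rel_omega1] by (rule trans_diff_Id)
  hence "(C'_rank Q le A, C'_rank Q le C) \<in> omega1 - Id"
    using AB BC unfolding C'_less_def by (meson transD)
  moreover have "qcclo_le le A C"
    using transp_onD[OF transp_on_C'[OF assms], of A B C] AB BC unfolding C'_less_def by blast
  ultimately show "C'_less Q le A C" using AB BC unfolding C'_less_def by blast
qed

text \<open>The first stage that contains a nonempty \<open>A\<close> is the initial one or a successor, never a limit.\<close>

lemma C'_decompose:
  assumes re: "reflp_on Q le" and A: "A \<in> C' Q le" "dom A \<noteq> {}"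
  shows "\<exists>L p R. decomposed Q le A L p R \<and>
    (\<forall>i. dom (L i) \<noteq> {} \<longrightarrow> C'_less Q le (L i) A) \<and> (\<forall>i. dom (R i) \<noteq> {} \<longrightarrow> C'_less Q le (R i) A)"
proof -
  define \<alpha> where "\<alpha> = C'_rank Q le A"
  note r = C'_rank[OF A(1), folded \<alpha>_def]
  show ?thesis
  proof (cases "\<exists>\<beta>\<in>Field omega1. \<alpha> = succ1 \<beta>")
    case True
    then obtain \<beta> where \<beta>: "\<beta> \<in> Field omega1" "\<alpha> = succ1 \<beta>" by blast
    have \<beta>\<alpha>: "(\<beta>, \<alpha>) \<in> omega1 - Id" using underS_succ1[OF \<beta>(1)] \<beta>(2) by (auto simp: underS_def)
    have "A \<in> unbounded_sums Q le (C'_stage Q le \<beta>)"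
      using r(2) r(3)[OF \<beta>\<alpha>] C'_stage_succ[OF \<beta>(1), of Q le] \<beta>(2) by simp
    then obtain L p R where s: "is_sum Q L p R A" and LR: "\<And>n. L n \<in> C'_stage Q le \<beta>" "\<And>n. R n \<in> C'_stage Q le \<beta>"
      and u: "unbounded_seq le L" "unbounded_seq le R"
      unfolding unbounded_sums_def unbounded_seq_def by blast
    have d: "decomposed Q le A L p R" by (rule decomposed_sum[OF s u])
    have less: "C'_less Q le B A" if B: "B \<in> C'_stage Q le \<beta>" "B \<subseteq>\<^sub>m A" for B
    proof -
      have "(C'_rank Q le B, \<beta>) \<in> omega1" by (rule C'_rank_le[OF \<beta>(1) B(1)])
      hence "(C'_rank Q le B, \<alpha>) \<in> omega1 - Id"
        using \<beta>\<alpha> wo_rel.TRANS[OF wo_rel_omega1] wo_rel.ANTISYM[OF wo_rel_omega1]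
        by (auto dest: transD antisymD)
      moreover have "B \<in> C' Q le" using B(1) \<beta>(1) by (auto simp: C'_def)
      moreover have "qcclo_le le B A"
        by (rule qcclo_le_map_le[OF re _ B(2)]) (use B(1) C'_stage_qcclos in blast)
      ultimately show ?thesis using A(1) unfolding C'_less_def \<alpha>_def by blast
    qed
    have "L i \<subseteq>\<^sub>m A" "R i \<subseteq>\<^sub>m A" for i using d by (simp_all add: decomposed_def)
    thus ?thesis using d less LR by blast
  next
    case False
    have "underS omega1 \<alpha> = {}"
    proof (rule ccontr)
      assume ne: "underS omega1 \<alpha> \<noteq> {}"
      have "C'_stage Q le \<alpha> = (\<Union>\<beta>\<in>underS omega1 \<alpha>. C'_stage Q le \<beta>)"
        using False by (intro C'_stage_limit ne) blast
      then obtain \<beta> where "\<beta> \<in> underS omega1 \<alpha>" "A \<in> C'_stage Q le \<beta>" using r(2) by auto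
      thus False using r(3)[of \<beta>] by (auto simp: underS_def)
    qed
    hence "A \<in> qcclos Q" "is_singleton (dom A)" using r(2) A(2) by (auto simp: C'_stage_zero)
    then obtain x where "dom A = {x}" by (auto simp: is_singleton_def)
    from decomposed_singleton[OF re \<open>A \<in> qcclos Q\<close> this] show ?thesis by auto
  qed
qed

section \<open>The hierarchy is better-quasi-ordered\<close>

theorem theorem20:
  fixes Q :: "'q set" and le :: "'q \<Rightarrow> 'q \<Rightarrow> bool"
  assumes "bqo_on Q le"
  shows "bqo_on (C' Q le) (qcclo_le le)"
proof -
  have re: "reflp_on Q le" and tr: "transp_on Q le" and noQ: "\<And>M f. \<not> bad_array Q le M f"
    using assms unfolding bqo_on_iff_arrays quasi_order_on_def by blast+
  have "quasi_order_on (C' Q le) (qcclo_le le)"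
    unfolding quasi_order_on_def
  proof
    show "reflp_on (C' Q le) (qcclo_le le)"
      by (rule reflp_onI) (use qcclo_le_refl[OF re] C'_qcclos in blast)
  qed (rule transp_on_C'[OF tr])
  moreover have "\<not> bad_array (C' Q le) (qcclo_le le) M0 f0" for M0 f0
  proof
    define C where "C = {A \<in> C' Q le. dom A \<noteq> {}}"
    assume bad0: "bad_array (C' Q le) (qcclo_le le) M0 f0"
    \<comment> \<open>The empty ordering embeds into everything, so it is no value of a bad array.\<close>
    have "dom (f0 X) \<noteq> {}" if X: "X \<in> subs M0" for X
    proof
      assume e: "dom (f0 X) = {}"
      have "qcclo_le le (f0 X) (f0 (tail X))"
        unfolding qcclo_le_def e smc_embedding_def by simp
      thus False using bad0 X by (simp add: bad_array_def)
    qed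
    hence "bad_array C (qcclo_le le) M0 f0" using bad0 by (simp add: bad_array_def C_def)
    moreover have trC: "transp_on C (qcclo_le le)"
      by (rule transp_on_subset[OF transp_on_C'[OF tr]]) (auto simp: C_def)
    moreover have "\<And>A B. C'_less Q le A B \<Longrightarrow> qcclo_le le A B" by (simp add: C'_less_def)
    ultimately have "\<exists>M f. bad_array C (qcclo_le le) M f \<and> (\<forall>N g. N \<subseteq> M \<longrightarrow>
        bad_array C (qcclo_le le) N g \<longrightarrow> (\<exists>X\<in>subs N. \<not> C'_less Q le (g X) (f X)))"
      by (intro minimal_bad_array[OF _ wfp_C'_less transp_C'_less[OF tr]])
    then obtain M f where bad: "bad_array C (qcclo_le le) M f"
      and min: "\<And>N g. N \<subseteq> M \<Longrightarrow> bad_array C (qcclo_le le) N g \<Longrightarrow> \<exists>X\<in>subs N. \<not> C'_less Q le (g X) (f X)"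
      by blast
    have "\<forall>A. \<exists>L p R. A \<in> C \<longrightarrow> decomposed Q le A L p R \<and>
      (\<forall>i. dom (L i) \<noteq> {} \<longrightarrow> C'_less Q le (L i) A) \<and> (\<forall>i. dom (R i) \<noteq> {} \<longrightarrow> C'_less Q le (R i) A)"
      using C'_decompose[OF re] unfolding C_def by blast
    then obtain L p R where dec: "\<And>A. A \<in> C \<Longrightarrow> decomposed Q le A (L A) (p A) (R A)"
      and Lless: "\<And>A i. A \<in> C \<Longrightarrow> dom (L A i) \<noteq> {} \<Longrightarrow> C'_less Q le (L A i) A"
      and Rless: "\<And>A i. A \<in> C \<Longrightarrow> dom (R A i) \<noteq> {} \<Longrightarrow> C'_less Q le (R A i) A"
      by metis
    have infM: "infinite M" and cont: "cont_on_subs M f"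
      and fC: "\<And>X. X \<in> subs M \<Longrightarrow> f X \<in> C" and fbad: "\<And>X. X \<in> subs M \<Longrightarrow> \<not> qcclo_le le (f X) (f (tail X))"
      using bad by (auto simp: bad_array_def)
    have cont2: "cont_on_subs M (\<lambda>X. (f X, f (tail X)))"
      by (rule cont_on_subs_Pair[OF cont cont_on_subs_tail[OF cont]])
    \<comment> \<open>\<open>D S A B i\<close>: with \<open>S\<close> the choice of the left or of the right summands, the \<open>i\<close>-th summand of \<open>A\<close>
      embeds into no summand of \<open>B\<close> on the same side.\<close>
    define D where "D S A B i \<longleftrightarrow> dom (S A i) \<noteq> {} \<and> (\<forall>j. \<not> qcclo_le le (S A i) (S B j))"
      for S :: "(real \<rightharpoonup> 'q) \<Rightarrow> nat \<Rightarrow> real \<rightharpoonup> 'q" and A B i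
    \<comment> \<open>Such summands cannot exist for all \<open>X\<close>: they would form a bad array strictly below \<open>f\<close>.\<close>
    have noD: "\<not> (\<forall>X\<in>subs N. \<exists>i. D S (f X) (f (tail X)) i)"
      if N: "N \<in> subs M" and S: "\<And>A i. A \<in> C \<Longrightarrow> dom (S A i) \<noteq> {} \<Longrightarrow> C'_less Q le (S A i) A" for N S
    proof
      assume all: "\<forall>X\<in>subs N. \<exists>i. D S (f X) (f (tail X)) i"
      define g where "g X = (\<lambda>(A, B). S A (SOME i. D S A B i)) (f X, f (tail X))" for X
      have NM: "N \<subseteq> M" "infinite N" using N by (auto simp: subs_def)
      note sNM = subs_mono[OF NM(1)]
      have gX: "\<exists>i. g X = S (f X) i \<and> D S (f X) (f (tail X)) i" if "X \<in> subs N" for X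
        using someI_ex[OF bspec[OF all that]] by (auto simp: g_def)
      have gless: "C'_less Q le (g X) (f X)" if X: "X \<in> subs N" for X
        using gX[OF X] S[OF fC[OF sNM[OF X]]] by (auto simp: D_def)
      have "bad_array C (qcclo_le le) N g"
        unfolding bad_array_def
      proof (intro conjI ballI NM(2))
        show "cont_on_subs N g"
          unfolding g_def by (rule cont_on_subs_comp[OF cont_on_subs_mono[OF cont2 NM(1)]])
        fix X assume X: "X \<in> subs N"
        show "g X \<in> C" using gless[OF X] gX[OF X] by (auto simp: C_def C'_less_def D_def)
        show "\<not> qcclo_le le (g X) (g (tail X))"
          using gX[OF X] gX[OF tail_subs[OF X]] by (auto simp: D_def)
      qed
      from min[OF NM(1) this] gless show False by blast
    qed
    obtain N1 where N1: "N1 \<in> subs M" "(\<forall>X\<in>subs N1. le (p (f X)) (p (f (tail X)))) \<or>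
        (\<forall>X\<in>subs N1. \<not> le (p (f X)) (p (f (tail X))))"
      using ramsey_cont[OF infM cont_on_subs_comp[OF cont2, of "\<lambda>(A, B). le (p A) (p B)"]] by auto
    have sub1: "X \<in> subs M" if "X \<in> subs N1" for X using N1(1) that by (auto simp: subs_def)
    have le1: "le (p (f X)) (p (f (tail X)))" if "X \<in> subs N1" for X
    proof -
      have "\<not> (\<forall>X\<in>subs N1. \<not> le (p (f X)) (p (f (tail X))))"
      proof
        assume "\<forall>X\<in>subs N1. \<not> le (p (f X)) (p (f (tail X)))"
        moreover have "p (f X) \<in> Q" if "X \<in> subs N1" for X
          using dec[OF fC[OF sub1[OF that]]] by (simp add: decomposed_def)
        moreover have "cont_on_subs N1 (\<lambda>X. p (f X))"
          by (rule cont_on_subs_comp[OF cont_on_subs_mono[OF cont]]) (use N1 in \<open>simp add: subs_def\<close>)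
        ultimately have "bad_array Q le N1 (\<lambda>X. p (f X))"
          using N1(1) by (simp add: bad_array_def subs_def)
        thus False using noQ by blast
      qed
      thus ?thesis using N1(2) that by blast
    qed
    have inf1: "infinite N1" and N1M: "N1 \<subseteq> M" using N1 by (auto simp: subs_def)
    obtain N2 where N2: "N2 \<in> subs N1" "(\<forall>X\<in>subs N2. \<exists>i. D L (f X) (f (tail X)) i) \<or>
        (\<forall>X\<in>subs N2. \<not> (\<exists>i. D L (f X) (f (tail X)) i))"
      using ramsey_cont[OF inf1 cont_on_subs_comp[OF cont_on_subs_mono[OF cont2 N1M], of "\<lambda>(A, B). \<exists>i. D L A B i"]]
      by auto
    have sub2: "X \<in> subs N1" if "X \<in> subs N2" for X using N2(1) that by (auto simp: subs_def)
    have N2M: "N2 \<in> subs M" by (rule sub1[OF N2(1)])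
    have noL: "\<not> D L (f X) (f (tail X)) i" if "X \<in> subs N2" for X i
      using noD[where S = L, OF N2M Lless] N2(2) that by blast
    have "\<exists>i. D R (f X) (f (tail X)) i" if X: "X \<in> subs N2" for X
    proof (rule ccontr)
      assume noR: "\<not> ?thesis"
      have XM: "X \<in> subs M" by (rule sub1[OF sub2[OF X]])
      have "qcclo_le le (f X) (f (tail X))"
      proof (rule qcclo_le_decomposed[OF tr re dec dec])
        show "f X \<in> C" "f (tail X) \<in> C" using fC XM tail_subs[OF XM] by blast+
        show "le (p (f X)) (p (f (tail X)))" by (rule le1[OF sub2[OF X]])
        show "\<exists>j. qcclo_le le (L (f X) i) (L (f (tail X)) j)" if "dom (L (f X) i) \<noteq> {}" for i
          using noL[OF X, of i] that unfolding D_def by blast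
        show "\<exists>j. qcclo_le le (R (f X) i) (R (f (tail X)) j)" if "dom (R (f X) i) \<noteq> {}" for i
          using noR that unfolding D_def by blast
      qed
      thus False using fbad[OF XM] by blast
    qed
    thus False using noD[where S = R, OF N2M Rless] by blast
  qed
  ultimately show ?thesis unfolding bqo_on_iff_arrays by blast
qed

end
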